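(* Let $\xi=\ker(z\,d\theta+x\,dy-y\,dx)$ be the standard tight contact structure on $\mathbb{S}^1\times\mathbb{S}^2$. There exists a positive non-contractible loop in $\operatorname{Cont}(\mathbb{S}^1\times\mathbb{S}^2,\xi)$, i.e. a positive loop representing a non-trivial class in $\pi_1(\operatorname{Cont}(\mathbb{S}^1\times\mathbb{S}^2,\xi))$.
   Context: Coordinates on $\mathbb{S}^1\times\mathbb{S}^2$ are $(\theta;x,y,z)\in\mathbb{S}^1\times\mathbb{R}^3$ with $x^2+y^2+z^2=1$. $\operatorname{Cont}(\mathbb{S}^1\times\mathbb{S}^2,\xi)$ is the group of contactomorphisms, with $\pi_1$ based at the identity. A loop $\{\varphi_t\}_{t\in\mathbb{S}^1}$ of contactomorphisms based at the identity is positive if its generating time-dependent vector field $X_t$, defined by $\frac{d}{dt}\varphi_t=X_t\circ\varphi_t$, is everywhere positively transverse to the cooriented contact structure, i.e. the contact Hamiltonian $\alpha(X_t)$ is everywhere positive for a contact form $\alpha$ with $\ker\alpha=\xi$ defining the coorientation. *)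

theory Defs
  imports "HOL-Analysis.Analysis" "HOL-Combinatorics.Permutations"
begin

fun iterated_derivative ::
    "'a::euclidean_space list \<Rightarrow> ('a \<Rightarrow> 'b::real_normed_vector) \<Rightarrow> 'a \<Rightarrow> 'b" where
  "iterated_derivative [] f = f"
| "iterated_derivative (v # vs) f =
     (\<lambda>x. frechet_derivative (iterated_derivative vs f) (at x) v)"

definition smooth_on_open ::
    "'a::euclidean_space set \<Rightarrow> ('a \<Rightarrow> 'b::real_normed_vector) \<Rightarrow> bool" where
  "smooth_on_open U f \<longleftrightarrow>
     open U \<and> (\<forall>vs. \<forall>x\<in>U. iterated_derivative vs f differentiable (at x))"

text \<open>Smoothness on an arbitrary subset of a Euclidean space: local existence of smooth
  extensions. On an embedded submanifold this is smoothness in charts.\<close>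

definition smooth_map_on ::
    "'a::euclidean_space set \<Rightarrow> ('a \<Rightarrow> 'b::real_normed_vector) \<Rightarrow> bool" where
  "smooth_map_on M f \<longleftrightarrow>
     (\<forall>p\<in>M. \<exists>U F. p \<in> U \<and> smooth_on_open U F \<and> (\<forall>q\<in>M \<inter> U. F q = f q))"

type_synonym ambient = "complex \<times> (real ^ 3)"

text \<open>The point \<open>(\<theta>; x, y, z)\<close> is represented by \<open>(cis \<theta>, vector [x, y, z])\<close>.\<close>

definition S1xS2 :: "ambient set" where
  "S1xS2 = sphere 0 1 \<times> sphere 0 1"

definition tangent_S1xS2 :: "ambient \<Rightarrow> ambient set" where
  "tangent_S1xS2 m = {v. fst m \<bullet> fst v = 0 \<and> snd m \<bullet> snd v = 0}"

text \<open>The form \<open>z d\<theta> + x dy - y dx\<close> at the point \<open>m\<close>, applied to the vector \<open>v\<close>. If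
  \<open>u = cis \<theta>\<close> moves with velocity \<open>w\<close>, then \<open>w = \<i> \<theta>' u\<close>, so \<open>d\<theta>(w) = \<theta>' = Im (cnj u * w)\<close>.\<close>

definition contact_form :: "ambient \<Rightarrow> ambient \<Rightarrow> real" where
  "contact_form m v =
     (let x = snd m $ 1; y = snd m $ 2; z = snd m $ 3;
          d\<theta> = Im (cnj (fst m) * fst v); dx = snd v $ 1; dy = snd v $ 2
      in z * d\<theta> + x * dy - y * dx)"

definition contact_structure :: "ambient \<Rightarrow> ambient set" where
  "contact_structure m = {v \<in> tangent_S1xS2 m. contact_form m v = 0}"

text \<open>A self-map of the manifold is represented by its extension to the ambient space by the
  identity, so that the identity is \<^term>\<open>id\<close> and inverses are given by \<^term>\<open>inv\<close>.\<close>

definition diffeomorphism :: "(ambient \<Rightarrow> ambient) \<Rightarrow> bool" where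
  "diffeomorphism f \<longleftrightarrow>
     f permutes S1xS2 \<and> smooth_map_on S1xS2 f \<and> smooth_map_on S1xS2 (inv f)"

text \<open>A derivative within the submanifold is not unique as a linear map on the ambient space,
  but it is determined on tangent vectors, where it is the differential.\<close>

definition contactomorphisms :: "(ambient \<Rightarrow> ambient) set" where
  "contactomorphisms = {f. diffeomorphism f \<and>
     (\<forall>m\<in>S1xS2. frechet_derivative f (at m within S1xS2) ` contact_structure m
        = contact_structure (f m))}"

definition local_parametrization :: "(real ^ 3) set \<Rightarrow> (real ^ 3 \<Rightarrow> ambient) \<Rightarrow> bool" where
  "local_parametrization U \<psi> \<longleftrightarrow>
     smooth_on_open U \<psi> \<and>
     openin (top_of_set S1xS2) (\<psi> ` U) \<and>
     (\<exists>\<zeta>. homeomorphism U (\<psi> ` U) \<psi> \<zeta>) \<and>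
     (\<forall>x\<in>U. inj (frechet_derivative \<psi> (at x)))"

text \<open>The \<open>C\<^sup>\<infinity>\<close> topology on smooth maps from the manifold to the ambient space: uniform
  convergence, in charts, of all partial derivatives on compact sets.\<close>

definition smooth_nbhd ::
    "(real ^ 3 \<Rightarrow> ambient) \<Rightarrow> (real ^ 3) set \<Rightarrow> (real ^ 3) list \<Rightarrow> real \<Rightarrow>
     (ambient \<Rightarrow> ambient) \<Rightarrow> (ambient \<Rightarrow> ambient) set" where
  "smooth_nbhd \<psi> K vs \<epsilon> f = {g. smooth_map_on S1xS2 g \<and>
     (\<forall>x\<in>K. dist (iterated_derivative vs (g \<circ> \<psi>) x) (iterated_derivative vs (f \<circ> \<psi>) x) < \<epsilon>)}"

definition smooth_topology :: "(ambient \<Rightarrow> ambient) topology" where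
  "smooth_topology = topology_generated_by
     {smooth_nbhd \<psi> K vs \<epsilon> f | \<psi> U K vs \<epsilon> f.
        local_parametrization U \<psi> \<and> compact K \<and> K \<subseteq> U \<and> set vs \<subseteq> Basis \<and> 0 < \<epsilon> \<and>
        smooth_map_on S1xS2 f}"

definition Cont_topology :: "(ambient \<Rightarrow> ambient) topology" where
  "Cont_topology = subtopology smooth_topology contactomorphisms"

definition based_loop :: "'a topology \<Rightarrow> 'a \<Rightarrow> (real \<Rightarrow> 'a) \<Rightarrow> bool" where
  "based_loop X a \<gamma> \<longleftrightarrow> pathin X \<gamma> \<and> \<gamma> 0 = a \<and> \<gamma> 1 = a"

text \<open>The element of \<open>\<pi>\<^sub>1(X, a)\<close> represented by a based loop; the identity element is the class
  of the constant loop.\<close>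

definition pi1_class :: "'a topology \<Rightarrow> 'a \<Rightarrow> (real \<Rightarrow> 'a) \<Rightarrow> (real \<Rightarrow> 'a) set" where
  "pi1_class X a \<gamma> =
     {\<delta>. homotopic_with (\<lambda>\<rho>. \<rho> 0 = a \<and> \<rho> 1 = a) (top_of_set {0..1}) X \<gamma> \<delta>}"

text \<open>Loops are parametrized by \<open>\<real>/\<int>\<close>, as 1-periodic families.\<close>

definition smooth_contact_loop :: "(real \<Rightarrow> ambient \<Rightarrow> ambient) \<Rightarrow> bool" where
  "smooth_contact_loop \<phi> \<longleftrightarrow>
     (\<forall>t. \<phi> t \<in> contactomorphisms) \<and> (\<forall>t. \<phi> (t + 1) = \<phi> t) \<and> \<phi> 0 = id \<and>
     smooth_map_on (UNIV \<times> S1xS2) (\<lambda>(t, m). \<phi> t m)"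

definition generating_field :: "(real \<Rightarrow> ambient \<Rightarrow> ambient) \<Rightarrow> real \<Rightarrow> ambient \<Rightarrow> ambient" where
  "generating_field \<phi> t m = vector_derivative (\<lambda>s. \<phi> s (inv (\<phi> t) m)) (at t)"

definition positive_loop :: "(real \<Rightarrow> ambient \<Rightarrow> ambient) \<Rightarrow> bool" where
  "positive_loop \<phi> \<longleftrightarrow> smooth_contact_loop \<phi> \<and>
     (\<forall>t. \<forall>m\<in>S1xS2. contact_form m (generating_field \<phi> t m) > 0)"

end

theory Submission
  imports Defs "HOL-Complex_Analysis.Winding_Numbers"
begin

text \<open>Let \<open>T\<^sub>t\<close> and \<open>R\<^sub>t\<close> be the rotations of the circle and of the \<open>(x, y)\<close>-plane by the angle
  \<open>2 \<pi> t\<close>. Up to the factor \<open>2 \<pi>\<close> their contact Hamiltonians are \<open>z\<close> and \<open>x\<^sup>2 + y\<^sup>2\<close>, so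
  \<open>T\<^sub>t R\<^sub>k\<^sub>t\<close> is positive away from the circle over the south pole when \<open>k\<close> is large. A
  contactomorphism \<open>g\<close> that displaces this circle and fixes the points with \<open>z \<ge> 0\<close> repairs the defect:
  \<open>\<phi>\<^sub>t = T\<^sub>t R\<^sub>k\<^sub>t g R\<^sub>k\<^sub>t g\<^sup>-\<^sup>1\<close> is positive for large \<open>k\<close>. The \<open>S\<^sup>1\<close>-coordinate of the image of a point
  over the north pole winds once around the circle, so the loop is not contractible.\<close>

subsection \<open>Calculus of smooth maps on open sets\<close>

text \<open>On the south circle itself x^2 + y^2 vanishes, so no k makes z + k (x^2 + y^2) positive
  there. The Hamiltonian of a product of paths is that of the left path plus that of the right path,
  transported and multiplied by the conformal factor of the left one. For a point n and c = R g^-1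
  n, with R the rotation by k t, the Hamiltonian of the product along the trajectory of n is
  therefore, up to 2 pi, z + k (x^2 + y^2) at g c plus a positive factor times k (x^2 + y^2) at c.
  Over the south pole these two rotation terms could vanish together only if c and g c both lay on
  the south circle, which the displacement excludes. In the coordinates used to build g, all terms
  for z < 0 acquire a common positive factor, so a single bound on k works there, even as z tends to
  0. The last factor g^-1 makes the loop start at the identity, and an integer k closes it up. As g
  is the identity for z >= 0, the north pole sees only the rotation T.\<close>

primrec Ck :: "nat \<Rightarrow> 'a::euclidean_space set \<Rightarrow> ('a \<Rightarrow> 'b::real_normed_vector) \<Rightarrow> bool" where
  "Ck 0 U f \<longleftrightarrow> True"
| "Ck (Suc n) U f \<longleftrightarrow> (\<forall>x\<in>U. f differentiable (at x)) \<and>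
     (\<forall>v. Ck n U (\<lambda>x. frechet_derivative f (at x) v))"

lemma iterated_derivative_snoc:
  "iterated_derivative (vs @ [v]) f =
   iterated_derivative vs (\<lambda>x. frechet_derivative f (at x) v)"
  by (induction vs) auto

text \<open>Product and chain rules describe the first derivative in terms of the given functions,
  so inductions need \<open>Ck\<close>, which peels off the derivative taken first;
  \<open>iterated_derivative\<close> exposes the one taken last.
  \<open>iterated_derivative_snoc\<close> moves between the two orders.\<close>

lemma Ck_iff_iterated_derivative:
  "Ck n U f \<longleftrightarrow> (\<forall>vs. length vs < n \<longrightarrow> (\<forall>x\<in>U. iterated_derivative vs f differentiable (at x)))"
proof (induction n arbitrary: f)
  case (Suc n)
  have "(\<forall>vs. length vs < Suc n \<longrightarrow> (\<forall>x\<in>U. iterated_derivative vs f differentiable (at x))) \<longleftrightarrow>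
     (\<forall>x\<in>U. f differentiable (at x)) \<and> (\<forall>v vs. length vs < n \<longrightarrow>
        (\<forall>x\<in>U. iterated_derivative (vs @ [v]) f differentiable (at x)))" (is "?A \<longleftrightarrow> ?B")
  proof
    assume ?A
    then show ?B by (auto dest: spec[of _ "[]"] spec[of _ "_ @ [_]"])
  next
    assume B: ?B
    show ?A
    proof (intro allI impI ballI)
      fix vs :: "'a list" and x assume "length vs < Suc n" "x \<in> U"
      with B show "iterated_derivative vs f differentiable (at x)"
        by (cases vs rule: rev_cases) auto
    qed
  qed
  then show ?case using Suc by (auto simp: iterated_derivative_snoc)
qed simp

lemma smooth_on_open_iff_Ck: "smooth_on_open U f \<longleftrightarrow> open U \<and> (\<forall>n. Ck n U f)"
  unfolding smooth_on_open_def Ck_iff_iterated_derivative by blast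

lemma frechet_derivative_cong_open:
  assumes "open U" "x \<in> U" "\<And>y. y \<in> U \<Longrightarrow> f y = g y"
  shows "frechet_derivative f (at x) = frechet_derivative g (at x)"
proof -
  have "(f has_derivative D) (at x) \<longleftrightarrow> (g has_derivative D) (at x)" for D
    using assms by (metis has_derivative_transform_within_open)
  then show ?thesis by (simp add: frechet_derivative_def)
qed

lemma iterated_derivative_cong:
  assumes "open U" "\<And>y. y \<in> U \<Longrightarrow> f y = g y" "x \<in> U"
  shows "iterated_derivative vs f x = iterated_derivative vs g x"
  using assms(3)
proof (induction vs arbitrary: x)
  case (Cons v vs)
  then show ?case
    using frechet_derivative_cong_open[OF assms(1) \<open>x \<in> U\<close>, of "iterated_derivative vs f"]
    by simp
qed (use assms in auto)

lemma smooth_on_open_iterated_derivative_continuous: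
  assumes "smooth_on_open U f"
  shows "continuous_on U (iterated_derivative vs f)"
  using assms unfolding smooth_on_open_def
  by (meson continuous_at_imp_continuous_on differentiable_imp_continuous_within)

text \<open>Derivatives of all orders depend only on germs, and over an open set a local extension
  of \<open>f\<close> is \<open>f\<close> itself near the point. Hence the two notions of smoothness
  agree on open sets.\<close>

lemma smooth_on_open_local:
  assumes "open U"
    and "\<And>p. p \<in> U \<Longrightarrow> \<exists>V F. p \<in> V \<and> smooth_on_open V F \<and> (\<forall>q\<in>U \<inter> V. F q = f q)"
  shows "smooth_on_open U f"
  unfolding smooth_on_open_def
proof (intro conjI allI ballI)
  fix vs p assume p: "p \<in> U"
  then obtain V F where V: "p \<in> V" "smooth_on_open V F" "\<forall>q\<in>U \<inter> V. F q = f q"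
    using assms by blast
  have o: "open (U \<inter> V)" using V assms by (auto simp: smooth_on_open_def)
  have "iterated_derivative vs F differentiable (at p)"
    using V by (auto simp: smooth_on_open_def)
  moreover have "iterated_derivative vs F q = iterated_derivative vs f q" if "q \<in> U \<inter> V" for q
    using iterated_derivative_cong[OF o _ that] V by blast
  ultimately show "iterated_derivative vs f differentiable (at p)"
    unfolding differentiable_def using has_derivative_transform_within_open[OF _ o] p V
    by (metis IntI)
qed (fact assms)

lemma smooth_on_open_subset: "smooth_on_open U f \<Longrightarrow> open V \<Longrightarrow> V \<subseteq> U \<Longrightarrow> smooth_on_open V f"
  unfolding smooth_on_open_def by blast

lemma Ck_cong:
  assumes "open U" "\<And>x. x \<in> U \<Longrightarrow> f x = g x" "Ck n U f"
  shows "Ck n U g"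
  using assms(2,3)
proof (induction n arbitrary: f g)
  case (Suc n)
  have "g differentiable (at x)" if "x \<in> U" for x
    using Suc.prems that assms(1) has_derivative_transform_within_open
    unfolding differentiable_def Ck.simps by metis
  moreover have "Ck n U (\<lambda>x. frechet_derivative g (at x) v)" for v
    by (rule Suc.IH[of "\<lambda>x. frechet_derivative f (at x) v"])
      (use Suc.prems frechet_derivative_cong_open[OF assms(1), of _ f g] in auto)
  ultimately show ?case by simp
qed simp

lemma Ck_Suc_intro:
  assumes "open U" "\<And>x. x \<in> U \<Longrightarrow> (f has_derivative f' x) (at x)"
    and "\<And>v. Ck n U (\<lambda>x. f' x v)"
  shows "Ck (Suc n) U f"
proof -
  have "Ck n U (\<lambda>x. frechet_derivative f (at x) v)" for v
    by (rule Ck_cong[OF assms(1) _ assms(3)[of v]])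
      (use assms(2) frechet_derivative_at in fastforce)
  then show ?thesis using assms(2) by (auto simp: differentiable_def)
qed

lemma Ck_SucD:
  assumes "Ck (Suc n) U f"
  shows "x \<in> U \<Longrightarrow> (f has_derivative frechet_derivative f (at x)) (at x)"
    and "Ck n U (\<lambda>x. frechet_derivative f (at x) v)"
  using assms by (auto simp: frechet_derivative_works)

lemma Ck_Suc_imp: "Ck (Suc n) U f \<Longrightarrow> Ck n U f"
  by (auto simp: Ck_iff_iterated_derivative)

lemma Ck_const: "open U \<Longrightarrow> Ck n U (\<lambda>x. c)"
proof (induction n arbitrary: c)
  case (Suc n)
  show ?case by (rule Ck_Suc_intro[where f' = "\<lambda>_ _. 0"]) (use Suc in auto)
qed simp

lemma Ck_add: "open U \<Longrightarrow> Ck n U f \<Longrightarrow> Ck n U g \<Longrightarrow> Ck n U (\<lambda>x. f x + g x)"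
proof (induction n arbitrary: f g)
  case (Suc n)
  show ?case
    by (rule Ck_Suc_intro[OF _ has_derivative_add[OF Ck_SucD(1)[OF Suc.prems(2)] Ck_SucD(1)[OF Suc.prems(3)]]])
      (use Suc in auto)
qed simp

lemma Ck_linear: "bounded_linear L \<Longrightarrow> open U \<Longrightarrow> Ck n U f \<Longrightarrow> Ck n U (\<lambda>x. L (f x))"
proof (induction n arbitrary: f)
  case (Suc n)
  show ?case
    by (rule Ck_Suc_intro[OF _ bounded_linear.has_derivative[OF Suc.prems(1) Ck_SucD(1)[OF Suc.prems(3)]]])
      (use Suc in auto)
qed simp

lemma Ck_bilinear:
  assumes "bounded_bilinear P" "open U"
  shows "Ck n U f \<Longrightarrow> Ck n U g \<Longrightarrow> Ck n U (\<lambda>x. P (f x) (g x))"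
proof (induction n arbitrary: f g)
  case (Suc n)
  show ?case
    by (rule Ck_Suc_intro[OF assms(2) bounded_bilinear.FDERIV[OF assms(1) Ck_SucD(1)[OF Suc.prems(1)] Ck_SucD(1)[OF Suc.prems(2)]]])
      (use assms(2) Suc.prems in \<open>auto intro!: Ck_add Suc.IH dest: Ck_Suc_imp simp del: Ck.simps intro: Ck_SucD(2)\<close>)
qed simp

lemma Ck_sum:
  assumes "open U" "finite I" "\<And>i. i \<in> I \<Longrightarrow> Ck n U (f i)"
  shows "Ck n U (\<lambda>x. \<Sum>i\<in>I. f i x)"
  using assms(2,3) by (induction I) (auto intro!: Ck_add Ck_const assms(1))

text \<open>The chain rule differentiates \<open>f\<close> in a direction that varies with
  \<open>x\<close>, whereas \<open>Ck\<close> controls only fixed directions. Expanding the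
  direction in the standard basis turns the derivative into a finite sum of products to which the
  induction applies.\<close>

lemma Ck_compose:
  fixes f :: "'b::euclidean_space \<Rightarrow> 'c::real_normed_vector" and g :: "'a::euclidean_space \<Rightarrow> 'b"
  assumes "open U" "open V" "g ` U \<subseteq> V"
  shows "Ck n V f \<Longrightarrow> Ck n U g \<Longrightarrow> Ck n U (\<lambda>x. f (g x))"
proof (induction n arbitrary: f)
  case (Suc n)
  note g = Ck_SucD[OF Suc.prems(2)] and f = Ck_SucD[OF Suc.prems(1)]
  define f' where "f' x v = (\<Sum>b\<in>Basis. (frechet_derivative g (at x) v \<bullet> b) *\<^sub>R
     frechet_derivative f (at (g x)) b)" for x v
  show ?case
  proof (rule Ck_Suc_intro[OF assms(1), where f' = f'])
    fix x assume x: "x \<in> U"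
    then have Df: "(f has_derivative frechet_derivative f (at (g x))) (at (g x))"
      using f(1) assms by auto
    have "((\<lambda>x. f (g x)) has_derivative
        (\<lambda>v. frechet_derivative f (at (g x)) (frechet_derivative g (at x) v))) (at x)"
      using has_derivative_compose[OF g(1)[OF x] Df] by simp
    moreover have "frechet_derivative f (at (g x)) w =
        (\<Sum>b\<in>Basis. (w \<bullet> b) *\<^sub>R frechet_derivative f (at (g x)) b)" for w
    proof -
      note L = has_derivative_linear[OF Df]
      have "frechet_derivative f (at (g x)) (\<Sum>b\<in>Basis. (w \<bullet> b) *\<^sub>R b) =
          (\<Sum>b\<in>Basis. (w \<bullet> b) *\<^sub>R frechet_derivative f (at (g x)) b)"
        unfolding linear_sum[OF L] linear_scale[OF L] ..
      then show ?thesis unfolding euclidean_representation .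
    qed
    then have "(\<lambda>v. frechet_derivative f (at (g x)) (frechet_derivative g (at x) v)) = f' x"
      unfolding f'_def by (intro ext)
    ultimately show "((\<lambda>x. f (g x)) has_derivative f' x) (at x)" by simp
  next
    fix v
    show "Ck n U (\<lambda>x. f' x v)"
      unfolding f'_def
      by (intro Ck_sum Ck_bilinear[OF bounded_bilinear_scaleR] assms finite_Basis Suc.IH
          Ck_linear[OF bounded_linear_inner_left] f g Ck_Suc_imp[OF Suc.prems(2)])
  qed
qed simp

lemma smooth_on_open_const: "open U \<Longrightarrow> smooth_on_open U (\<lambda>x. c)"
  by (simp add: smooth_on_open_iff_Ck Ck_const)

lemma smooth_on_open_bounded_linear:
  assumes "open U" "bounded_linear L"
  shows "smooth_on_open U L"
proof -
  have "Ck n U L" for n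
  proof (cases n)
    case (Suc m)
    show ?thesis unfolding Suc
      by (rule Ck_Suc_intro[OF assms(1) bounded_linear_imp_has_derivative[OF assms(2)] Ck_const[OF assms(1)]])
  qed simp
  then show ?thesis using assms by (simp add: smooth_on_open_iff_Ck)
qed

lemma smooth_on_open_linear:
  "bounded_linear L \<Longrightarrow> smooth_on_open U f \<Longrightarrow> smooth_on_open U (\<lambda>x. L (f x))"
  by (simp add: smooth_on_open_iff_Ck Ck_linear)

lemma smooth_on_open_bilinear:
  "bounded_bilinear P \<Longrightarrow> smooth_on_open U f \<Longrightarrow> smooth_on_open U g \<Longrightarrow>
    smooth_on_open U (\<lambda>x. P (f x) (g x))"
  by (simp add: smooth_on_open_iff_Ck Ck_bilinear)

lemma smooth_on_open_compose:
  "smooth_on_open V f \<Longrightarrow> smooth_on_open U g \<Longrightarrow> g ` U \<subseteq> V \<Longrightarrow> smooth_on_open U (\<lambda>x. f (g x))"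
  unfolding smooth_on_open_iff_Ck using Ck_compose by blast

lemma smooth_on_open_add:
  "smooth_on_open U f \<Longrightarrow> smooth_on_open U g \<Longrightarrow> smooth_on_open U (\<lambda>x. f x + g x)"
  by (simp add: smooth_on_open_iff_Ck Ck_add)

lemma smooth_on_open_uminus: "smooth_on_open U f \<Longrightarrow> smooth_on_open U (\<lambda>x. - f x)"
  by (rule smooth_on_open_linear[OF bounded_linear_minus[OF bounded_linear_ident]])

lemma smooth_on_open_diff:
  "smooth_on_open U f \<Longrightarrow> smooth_on_open U g \<Longrightarrow> smooth_on_open U (\<lambda>x. f x - g x)"
  using smooth_on_open_add[of U f "\<lambda>x. - g x"] smooth_on_open_uminus[of U g] by simp

lemma smooth_on_open_mult:
  fixes f g :: "'a::euclidean_space \<Rightarrow> 'b::real_normed_algebra"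
  shows "smooth_on_open U f \<Longrightarrow> smooth_on_open U g \<Longrightarrow> smooth_on_open U (\<lambda>x. f x * g x)"
  by (rule smooth_on_open_bilinear[OF bounded_bilinear_mult])

lemma smooth_on_open_scaleR:
  "smooth_on_open U f \<Longrightarrow> smooth_on_open U g \<Longrightarrow> smooth_on_open U (\<lambda>x. f x *\<^sub>R g x)"
  by (rule smooth_on_open_bilinear[OF bounded_bilinear_scaleR])

lemma smooth_on_open_power2:
  fixes f :: "'a::euclidean_space \<Rightarrow> real"
  shows "smooth_on_open U f \<Longrightarrow> smooth_on_open U (\<lambda>x. (f x)\<^sup>2)"
  by (simp add: power2_eq_square smooth_on_open_mult)

lemma smooth_on_open_Pair:
  assumes "smooth_on_open U f" "smooth_on_open U g"
  shows "smooth_on_open U (\<lambda>x. (f x, g x))"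
proof -
  have "smooth_on_open U (\<lambda>x. (f x, 0) + (0, g x))"
    by (intro smooth_on_open_add smooth_on_open_linear[of "\<lambda>y. (y, 0)"]
        smooth_on_open_linear[of "\<lambda>y. (0, y)"] assms
        bounded_linear_Pair bounded_linear_ident bounded_linear_zero)
  then show ?thesis by simp
qed

lemma Ck_inverse: "Ck n (- {0}) (inverse :: real \<Rightarrow> real)"
proof (induction n)
  case (Suc n)
  have o: "open (- {0::real})" by auto
  show ?case
    by (rule Ck_Suc_intro[OF o has_derivative_inverse'])
      (use o Suc in \<open>auto intro!: Ck_bilinear[OF bounded_bilinear_mult] Ck_const
          Ck_linear[OF bounded_linear_minus[OF bounded_linear_ident]] simp del: Ck.simps\<close>)
qed simp

lemma smooth_on_open_inverse:
  fixes f :: "'a::euclidean_space \<Rightarrow> real"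
  assumes "smooth_on_open U f" "\<And>x. x \<in> U \<Longrightarrow> f x \<noteq> 0"
  shows "smooth_on_open U (\<lambda>x. inverse (f x))"
  by (rule smooth_on_open_compose[of "- {0}" inverse])
    (use assms Ck_inverse in \<open>auto simp: smooth_on_open_iff_Ck\<close>)

lemma smooth_on_open_divide:
  fixes f g :: "'a::euclidean_space \<Rightarrow> real"
  assumes "smooth_on_open U f" "smooth_on_open U g" "\<And>x. x \<in> U \<Longrightarrow> g x \<noteq> 0"
  shows "smooth_on_open U (\<lambda>x. f x / g x)"
  unfolding divide_inverse by (intro smooth_on_open_mult smooth_on_open_inverse assms)

lemma Ck_sqrt: "Ck n {0<..} sqrt"
proof (induction n)
  case (Suc n)
  have o: "open {0::real<..}" by auto
  have "((sqrt) has_derivative (\<lambda>h. h * (inverse (sqrt x) / 2))) (at x)" if "x \<in> {0<..}" for x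
    using DERIV_real_sqrt[of x] that
    by (simp add: has_field_derivative_def has_derivative_eq_rhs[OF _ ext] mult.commute)
  moreover have "Ck n {0<..} (\<lambda>x. v * (inverse (sqrt x) / 2))" for v :: real
    unfolding divide_inverse
    by (intro Ck_bilinear[OF bounded_bilinear_mult] Ck_const o Ck_compose[OF _ _ _ Ck_inverse] Suc) auto
  ultimately show ?case by (intro Ck_Suc_intro[OF o])
qed simp

lemma smooth_on_open_sqrt:
  fixes f :: "'a::euclidean_space \<Rightarrow> real"
  assumes "smooth_on_open U f" "\<And>x. x \<in> U \<Longrightarrow> f x > 0"
  shows "smooth_on_open U (\<lambda>x. sqrt (f x))"
  by (rule smooth_on_open_compose[of "{0<..}" sqrt])
    (use assms Ck_sqrt in \<open>auto simp: smooth_on_open_iff_Ck\<close>)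

text \<open>The free factor \<open>c\<close> absorbs the constant that each differentiation
  produces, so the family is closed under derivatives.\<close>

lemma Ck_cis: "Ck n UNIV (\<lambda>x. c * cis x)"
proof (induction n arbitrary: c)
  case (Suc n)
  have "((\<lambda>x. c * cis x) has_derivative (\<lambda>h. (h *\<^sub>R (c * \<i>)) * cis x)) (at x)" for x
    using has_derivative_mult[OF has_derivative_const[of c] has_derivative_cis[OF has_derivative_ident]]
    by (simp add: scaleR_conv_of_real mult_ac)
  then show ?case
    by (intro Ck_Suc_intro[OF open_UNIV, where f' = "\<lambda>x h. (h *\<^sub>R (c * \<i>)) * cis x"] Suc.IH)
qed simp

lemma smooth_on_open_cis:
  assumes "smooth_on_open U f"
  shows "smooth_on_open U (\<lambda>x. cis (f x))"
  by (rule smooth_on_open_compose[of UNIV cis])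
    (use assms Ck_cis[of _ 1] in \<open>auto simp: smooth_on_open_iff_Ck\<close>)

section \<open>A smooth cutoff: exp (-1 / x) and its derivatives, extended by zero\<close>

definition flat :: "nat \<Rightarrow> real \<Rightarrow> real" where
  "flat k x = (if x > 0 then exp (- 1 / x) / x ^ k else 0)"

text \<open>For N = k + 2 one has exp (1 / x) >= (1 + 1 / (N x))^N >= (1 / (N x))^N. The two powers
  beyond k leave a factor x^2, which makes the difference quotient at 0 tend to 0.\<close>

lemma flat_le_square: "\<bar>flat k x\<bar> \<le> real (k + 2) ^ (k + 2) * x\<^sup>2"
proof (cases "x > 0")
  case True
  define N where "N = real (k + 2)"
  have "N > 0" by (simp add: N_def)
  have "(1 / x / N) ^ (k + 2) \<le> (1 + 1 / x / N) ^ (k + 2)"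
    using True \<open>N > 0\<close> by (intro power_mono) auto
  also have "\<dots> \<le> exp (1 / x)"
    using exp_ge_one_plus_x_over_n_power_n[of "k + 2" "1 / x"] True unfolding N_def
    by (simp add: order_trans[of _ 0])
  finally have "1 \<le> N ^ (k + 2) * x ^ (k + 2) * exp (1 / x)"
    using True \<open>N > 0\<close> by (simp add: power_divide field_simps)
  then have "exp (- 1 / x) \<le> N ^ (k + 2) * x ^ (k + 2)"
    by (simp add: exp_minus field_simps)
  then have "exp (- 1 / x) / x ^ k \<le> N ^ (k + 2) * x\<^sup>2"
    using True by (simp add: divide_simps power_add power2_eq_square mult_ac)
  then show ?thesis using True by (simp add: flat_def N_def)
qed (simp add: flat_def)

lemma flat_has_real_derivative:
  "(flat k has_real_derivative (flat (k + 2) x - k * flat (Suc k) x)) (at x)"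
proof -
  consider "x > 0" | "x < 0" | "x = 0" by linarith
  then show ?thesis
  proof cases
    case 1
    have "((\<lambda>x. exp (- 1 / x) / x ^ k) has_real_derivative (flat (k + 2) x - k * flat (Suc k) x)) (at x)"
    proof (rule DERIV_cong)
      have "((\<lambda>x. x ^ k) has_real_derivative (k * x ^ k / x)) (at x)"
        using DERIV_pow[of k x] 1 by (cases k) auto
      moreover have "((\<lambda>x. exp (- 1 / x)) has_real_derivative (exp (- 1 / x) / x\<^sup>2)) (at x)"
        using 1 by (auto intro!: derivative_eq_intros simp: power2_eq_square)
      ultimately show "((\<lambda>x. exp (- 1 / x) / x ^ k) has_real_derivative
          (exp (- 1 / x) / x\<^sup>2 * x ^ k - exp (- 1 / x) * (k * x ^ k / x)) / (x ^ k * x ^ k)) (at x)"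
        using 1 by (intro DERIV_divide) auto
    qed (use 1 in \<open>simp add: flat_def field_simps power2_eq_square\<close>)
    then show ?thesis
      by (rule has_field_derivative_transform_within_open[where S = "{0<..}"])
        (use 1 in \<open>auto simp: flat_def\<close>)
  next
    case 2
    have "((\<lambda>x. 0) has_real_derivative 0) (at x)" by simp
    then have "(flat k has_real_derivative 0) (at x)"
      by (rule has_field_derivative_transform_within_open[where S = "{..<0}"])
        (use 2 in \<open>auto simp: flat_def\<close>)
    then show ?thesis using 2 by (simp add: flat_def)
  next
    case 3
    have "(\<lambda>h. flat k h / h) \<midarrow>0\<rightarrow> 0"
    proof (rule Lim_null_comparison)
      have "norm (flat k h / h) \<le> real (k + 2) ^ (k + 2) * \<bar>h\<bar>" if "h \<noteq> 0" for h
        using flat_le_square[of k h] that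
        by (simp add: field_simps power2_eq_square)
      then show "\<forall>\<^sub>F h in at 0. norm (flat k h / h) \<le> real (k + 2) ^ (k + 2) * \<bar>h\<bar>"
        by (simp add: eventually_at_filter)
      show "(\<lambda>h. real (k + 2) ^ (k + 2) * \<bar>h\<bar>) \<midarrow>0\<rightarrow> (0::real)"
        by (auto intro!: tendsto_eq_intros)
    qed
    then show ?thesis using 3 by (simp add: DERIV_def flat_def)
  qed
qed

text \<open>The derivative of \<open>flat k\<close> is a combination of \<open>flat (k + 2)\<close>
  and \<open>flat (Suc k)\<close>, so the induction treats all \<open>k\<close> at once. In
  particular \<open>flat 2\<close> is the derivative of \<open>flat 0\<close>.\<close>

lemma Ck_flat: "Ck n UNIV (flat k)"
proof (induction n arbitrary: k)
  case (Suc n)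
  have "Ck n UNIV (\<lambda>x. (flat (k + 2) x + (- real k) * flat (Suc k) x) * v)" for v
    by (intro Ck_bilinear[OF bounded_bilinear_mult] Ck_add Ck_const Suc.IH open_UNIV)
  then show ?case
    using flat_has_real_derivative[of k]
    by (intro Ck_Suc_intro[OF open_UNIV]) (auto simp: has_field_derivative_def)
qed simp

lemma smooth_on_open_flat:
  assumes "smooth_on_open U f"
  shows "smooth_on_open U (\<lambda>x. flat k (f x))"
  by (rule smooth_on_open_compose[of UNIV "flat k"])
    (use assms Ck_flat in \<open>auto simp: smooth_on_open_iff_Ck\<close>)

subsection \<open>Smooth maps between subsets of Euclidean spaces\<close>

lemma smooth_map_on_smooth_on_open: "smooth_on_open U f \<Longrightarrow> M \<subseteq> U \<Longrightarrow> smooth_map_on M f"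
  unfolding smooth_map_on_def by blast

lemma smooth_map_on_cong:
  assumes "smooth_map_on M f" "\<And>x. x \<in> M \<Longrightarrow> g x = f x"
  shows "smooth_map_on M g"
  using assms unfolding smooth_map_on_def by (metis IntE)

lemma smooth_on_open_iff_smooth_map_on:
  assumes "open U"
  shows "smooth_on_open U f \<longleftrightarrow> smooth_map_on U f"
  using smooth_map_on_smooth_on_open[of U f U] smooth_on_open_local[OF assms, of f]
  unfolding smooth_map_on_def by blast

lemma smooth_on_open_continuous_on: "smooth_on_open U f \<Longrightarrow> continuous_on U f"
  using smooth_on_open_iterated_derivative_continuous[of U f "[]"] by simp

lemma smooth_map_on_compose:
  assumes f: "smooth_map_on M f" and g: "smooth_map_on N g" and "f ` M \<subseteq> N"
  shows "smooth_map_on M (\<lambda>x. g (f x))"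
  unfolding smooth_map_on_def
proof
  fix p assume p: "p \<in> M"
  obtain U F where U: "p \<in> U" "smooth_on_open U F" "\<forall>q\<in>M \<inter> U. F q = f q"
    using f p unfolding smooth_map_on_def by blast
  obtain V G where V: "f p \<in> V" "smooth_on_open V G" "\<forall>q\<in>N \<inter> V. G q = g q"
    using g p assms(3) unfolding smooth_map_on_def by blast
  define W where "W = U \<inter> F -` V"
  have "open W"
    using continuous_open_preimage[OF smooth_on_open_continuous_on[OF U(2)], of V] U(2) V(2)
    unfolding W_def by (simp add: smooth_on_open_def)
  then have "smooth_on_open W (\<lambda>x. G (F x))"
    by (rule smooth_on_open_compose[OF V(2) smooth_on_open_subset[OF U(2)]])
      (auto simp: W_def)
  moreover have "p \<in> W" "\<forall>q\<in>M \<inter> W. G (F q) = g (f q)"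
    using U V p assms(3) by (auto simp: W_def)
  ultimately show "\<exists>U F. p \<in> U \<and> smooth_on_open U F \<and> (\<forall>q\<in>M \<inter> U. F q = g (f q))"
    by (intro exI[of _ W] exI[of _ "\<lambda>x. G (F x)"]) auto
qed

lemma smooth_map_on_Pair:
  assumes f: "smooth_map_on M f" and g: "smooth_map_on M g"
  shows "smooth_map_on M (\<lambda>x. (f x, g x))"
  unfolding smooth_map_on_def
proof
  fix p assume p: "p \<in> M"
  obtain U F where U: "p \<in> U" "smooth_on_open U F" "\<forall>q\<in>M \<inter> U. F q = f q"
    using f p unfolding smooth_map_on_def by blast
  obtain V G where V: "p \<in> V" "smooth_on_open V G" "\<forall>q\<in>M \<inter> V. G q = g q"
    using g p unfolding smooth_map_on_def by blast
  have "smooth_on_open (U \<inter> V) (\<lambda>x. (F x, G x))"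
    using U V by (intro smooth_on_open_Pair)
      (auto simp: smooth_on_open_def)
  then show "\<exists>U H. p \<in> U \<and> smooth_on_open U H \<and> (\<forall>q\<in>M \<inter> U. H q = (f q, g q))"
    using U V by (intro exI[of _ "U \<inter> V"] exI[of _ "\<lambda>x. (F x, G x)"]) auto
qed

lemma smooth_map_on_linear: "bounded_linear L \<Longrightarrow> smooth_map_on M L"
  using smooth_map_on_smooth_on_open[OF smooth_on_open_bounded_linear[OF open_UNIV]] by blast

lemma smooth_map_on_imp_differentiable_within:
  assumes "smooth_map_on M f" "m \<in> M"
  shows "f differentiable (at m within M)"
proof -
  obtain U F where U: "m \<in> U" "smooth_on_open U F" "\<forall>q\<in>M \<inter> U. F q = f q"
    using assms unfolding smooth_map_on_def by blast
  then obtain D where "(F has_derivative D) (at m within M)"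
    by (metis differentiable_def has_derivative_at_withinI iterated_derivative.simps(1) smooth_on_open_def)
  moreover have "\<forall>\<^sub>F q in at m within M. F q = f q"
  proof -
    have "\<forall>\<^sub>F q in at m within M. q \<in> U"
      using U by (meson eventually_at_topological smooth_on_open_def)
    moreover have "\<forall>\<^sub>F q in at m within M. q \<in> M"
      by (simp add: eventually_at_filter)
    ultimately show ?thesis by eventually_elim (use U in auto)
  qed
  ultimately have "(f has_derivative D) (at m within M)"
    using has_derivative_transform_eventually U assms(2) by blast
  then show ?thesis by (auto simp: differentiable_def)
qed

subsection \<open>Contactomorphisms of \<open>S\<^sup>1 \<times> S\<^sup>2\<close> in terms of curves\<close>

text \<open>With w = x + \<i> y the contact form becomes z d\<theta> + Im (cnj w dw), so that both
  rotations are multiplications by unit complex numbers.\<close>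

definition planar :: "ambient \<Rightarrow> complex" where
  "planar m = Complex (snd m $ 1) (snd m $ 2)"

definition height :: "ambient \<Rightarrow> real" where
  "height m = snd m $ 3"

definition point :: "complex \<Rightarrow> complex \<Rightarrow> real \<Rightarrow> ambient" where
  "point u w h = (u, vector [Re w, Im w, h])"

lemma point_simps [simp]:
  "fst (point u w h) = u" "planar (point u w h) = w" "height (point u w h) = h"
  by (simp_all add: point_def planar_def height_def)

lemma point_eta [simp]: "point (fst m) (planar m) (height m) = m"
  by (simp add: point_def planar_def height_def prod_eq_iff vec_eq_iff forall_3)

lemma ambient_eqI: "fst m = fst n \<Longrightarrow> planar m = planar n \<Longrightarrow> height m = height n \<Longrightarrow> m = n"
  by (metis point_eta)

lemma S1xS2_iff: "m \<in> S1xS2 \<longleftrightarrow> cmod (fst m) = 1 \<and> (cmod (planar m))\<^sup>2 + (height m)\<^sup>2 = 1"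
proof -
  have "norm (snd m) = 1 \<longleftrightarrow> (cmod (planar m))\<^sup>2 + (height m)\<^sup>2 = 1"
    by (simp add: norm_eq_1 planar_def height_def inner_vec_def sum_3 cmod_power2)
      (simp add: power2_eq_square)
  then show ?thesis by (cases m) (auto simp: S1xS2_def)
qed

lemma contact_form_eq:
  "contact_form m v = height m * Im (cnj (fst m) * fst v) + Im (cnj (planar m) * planar v)"
  by (simp add: contact_form_def Let_def planar_def height_def)

lemma bounded_linear_planar: "bounded_linear planar"
  unfolding linear_conv_bounded_linear [symmetric]
  by (rule linearI) (simp_all add: planar_def complex_eq_iff)

lemma bounded_linear_height: "bounded_linear height"
  unfolding linear_conv_bounded_linear [symmetric]
  by (rule linearI) (simp_all add: height_def)

lemma bounded_linear_point: "bounded_linear (\<lambda>(u, w, h). point u w h)"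
  unfolding linear_conv_bounded_linear [symmetric]
  by (rule linearI) (auto simp: point_def vec_eq_iff forall_3)

lemma has_vector_derivative_point:
  assumes "(u has_vector_derivative u') (at t)" "(w has_vector_derivative w') (at t)"
    "(h has_vector_derivative h') (at t)"
  shows "((\<lambda>t. point (u t) (w t) (h t)) has_vector_derivative point u' w' h') (at t)"
  using bounded_linear.has_vector_derivative[OF bounded_linear_point
      has_vector_derivative_Pair[OF assms(1) has_vector_derivative_Pair[OF assms(2,3)]]]
  by simp

lemma smooth_on_open_point:
  assumes "smooth_on_open U u" "smooth_on_open U w" "smooth_on_open U h"
  shows "smooth_on_open U (\<lambda>x. point (u x) (w x) (h x))"
  using smooth_on_open_linear[OF bounded_linear_point
      smooth_on_open_Pair[OF assms(1) smooth_on_open_Pair[OF assms(2,3)]]]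
  by simp

lemmas has_vector_derivative_components =
  bounded_linear.has_vector_derivative[OF bounded_linear_fst]
  bounded_linear.has_vector_derivative[OF bounded_linear_planar]
  bounded_linear.has_vector_derivative[OF bounded_linear_height]

section \<open>Tangent vectors as velocities of curves\<close>

lemma curve_in_sphere:
  fixes p v :: "'a::real_inner"
  assumes "norm p = 1" "p \<bullet> v = 0"
  obtains c :: "real \<Rightarrow> 'a" where "\<And>t. norm (c t) = 1" "c 0 = p" "(c has_vector_derivative v) (at 0)"
proof
  \<comment> \<open>The great circle through \<open>p\<close> with speed \<open>norm v\<close>; for
    \<open>v = 0\<close> it is constant, because then \<open>sgn v = 0\<close>.\<close>
  define c where "c t = cos (t * norm v) *\<^sub>R p + sin (t * norm v) *\<^sub>R sgn v" for t
  show "c 0 = p" by (simp add: c_def)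
  have "p \<bullet> p = 1" "p \<bullet> sgn v = 0" "v \<noteq> 0 \<Longrightarrow> sgn v \<bullet> sgn v = 1"
    using assms by (simp_all add: dot_square_norm sgn_div_norm norm_eq_1)
  then have "c t \<bullet> c t = 1" for t
    by (cases "v = 0") (auto simp: c_def inner_add inner_commute power2_eq_square[symmetric])
  then show "norm (c t) = 1" for t by (simp add: norm_eq_1)
  have "norm v *\<^sub>R sgn v = v" by (cases "v = 0") (simp_all add: sgn_div_norm)
  then show "(c has_vector_derivative v) (at 0)"
    unfolding c_def by (auto intro!: derivative_eq_intros)
qed

text \<open>Testing derivatives on curves loses nothing: every tangent vector occurs as a
  velocity.\<close>

lemma curve_in_S1xS2:
  assumes "m \<in> S1xS2" "v \<in> tangent_S1xS2 m"
  obtains c where "\<And>t. c t \<in> S1xS2" "c 0 = m" "(c has_vector_derivative v) (at 0)"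
proof -
  obtain c1 where c1: "\<And>t. norm (c1 t) = 1" "c1 0 = fst m" "(c1 has_vector_derivative fst v) (at 0)"
    using assms curve_in_sphere[of "fst m" "fst v"]
    by (auto simp: S1xS2_def tangent_S1xS2_def mem_Times_iff)
  obtain c2 where c2: "\<And>t. norm (c2 t) = 1" "c2 0 = snd m" "(c2 has_vector_derivative snd v) (at 0)"
    using assms curve_in_sphere[of "snd m" "snd v"]
    by (auto simp: S1xS2_def tangent_S1xS2_def mem_Times_iff)
  show ?thesis
    by (rule that[of "\<lambda>t. (c1 t, c2 t)"])
      (use c1 c2 has_vector_derivative_Pair[OF c1(3) c2(3)] in \<open>auto simp: S1xS2_def\<close>)
qed

lemma inner_derivative_of_unit_curve:
  fixes c :: "real \<Rightarrow> 'a::real_inner"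
  assumes "\<And>s. norm (c s) = 1" "(c has_vector_derivative v) (at t)"
  shows "c t \<bullet> v = 0"
proof -
  have "((\<lambda>s. c s \<bullet> c s) has_vector_derivative (c t \<bullet> v + v \<bullet> c t)) (at t)"
    using bounded_bilinear.has_vector_derivative[OF bounded_bilinear_inner assms(2,2)] .
  then have "((\<lambda>s. c s \<bullet> c s) has_real_derivative (c t \<bullet> v + v \<bullet> c t)) (at t)"
    by (simp add: has_real_derivative_iff_has_vector_derivative)
  moreover have "((\<lambda>s. c s \<bullet> c s) has_real_derivative 0) (at t)"
    using assms(1) by (simp add: dot_square_norm)
  ultimately show ?thesis using DERIV_unique by (fastforce simp: inner_commute)
qed

lemma tangent_of_curve:
  assumes "\<And>s. c s \<in> S1xS2" "(c has_vector_derivative v) (at t)"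
  shows "v \<in> tangent_S1xS2 (c t)"
proof -
  have "fst (c t) \<bullet> fst v = 0" "snd (c t) \<bullet> snd v = 0"
    using assms(1) by (auto intro!: inner_derivative_of_unit_curve
        bounded_linear.has_vector_derivative[OF bounded_linear_fst assms(2)]
        bounded_linear.has_vector_derivative[OF bounded_linear_snd assms(2)]
        simp: S1xS2_def mem_Times_iff)
  then show ?thesis by (simp add: tangent_S1xS2_def)
qed

text \<open>The condition \<open>f\<^sup>* \<alpha> = \<kappa> \<alpha>\<close> with \<open>\<kappa> > 0\<close>, tested on curves: derivatives within the submanifold
  are only determined on tangent vectors, and those are the velocities of curves.\<close>

definition conformal :: "(ambient \<Rightarrow> ambient) \<Rightarrow> (ambient \<Rightarrow> real) \<Rightarrow> bool" where
  "conformal f \<kappa> \<longleftrightarrow> (\<forall>m\<in>S1xS2. \<kappa> m > 0) \<and>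
     (\<forall>c t v. (\<forall>s. c s \<in> S1xS2) \<and> (c has_vector_derivative v) (at t) \<longrightarrow>
        (\<exists>w. ((\<lambda>s. f (c s)) has_vector_derivative w) (at t) \<and>
           contact_form (f (c t)) w = \<kappa> (c t) * contact_form (c t) v))"

lemma conformalD:
  assumes "conformal f \<kappa>" "\<And>s. c s \<in> S1xS2" "(c has_vector_derivative v) (at t)"
  obtains w where "((\<lambda>s. f (c s)) has_vector_derivative w) (at t)"
    "contact_form (f (c t)) w = \<kappa> (c t) * contact_form (c t) v"
  using assms unfolding conformal_def by blast

text \<open>A sufficient condition for membership in \<open>contactomorphisms\<close> that composes
  and inverts without any computation of derivatives within a subset.\<close>

definition contact_symmetry :: "(ambient \<Rightarrow> ambient) \<Rightarrow> bool" where
  "contact_symmetry f \<longleftrightarrow> diffeomorphism f \<and> (\<exists>\<kappa>. conformal f \<kappa>)"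

lemma diffeomorphism_inv: "diffeomorphism f \<Longrightarrow> diffeomorphism (inv f)"
  by (auto simp: diffeomorphism_def permutes_inv permutes_inv_inv)

lemma diffeomorphism_mem: "diffeomorphism f \<Longrightarrow> f m \<in> S1xS2 \<longleftrightarrow> m \<in> S1xS2"
  by (simp add: diffeomorphism_def permutes_in_image)

lemma diffeomorphism_inverses:
  assumes "diffeomorphism f"
  shows "f (inv f m) = m" "inv f (f m) = m"
  using assms by (auto simp: diffeomorphism_def intro: permutes_inverses)

lemma diffeomorphism_comp:
  assumes "diffeomorphism f" "diffeomorphism g"
  shows "diffeomorphism (f \<circ> g)"
proof -
  have p: "f permutes S1xS2" "g permutes S1xS2"
    using assms by (simp_all add: diffeomorphism_def)
  have "inv (f \<circ> g) = inv g \<circ> inv f"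
    by (intro o_inv_distrib permutes_bij[OF p(1)] permutes_bij[OF p(2)])
  moreover have "smooth_map_on S1xS2 (\<lambda>x. f (g x))"
    by (rule smooth_map_on_compose[of S1xS2 _ S1xS2])
      (use assms p in \<open>auto simp: diffeomorphism_def permutes_in_image\<close>)
  moreover have "smooth_map_on S1xS2 (\<lambda>x. inv g (inv f x))"
    by (rule smooth_map_on_compose[of S1xS2 _ S1xS2])
      (use assms p in \<open>auto simp: diffeomorphism_def permutes_in_image[OF permutes_inv]\<close>)
  ultimately show ?thesis
    using permutes_compose[OF p(2,1)] by (simp add: diffeomorphism_def comp_def)
qed

text \<open>Whatever linear map the choice operator in \<open>frechet_derivative\<close> selects,
  its restriction to the range of the curve obeys the chain rule, so its value on a velocity is the
  true one.\<close>

lemma diffeomorphism_along_curve: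
  assumes "diffeomorphism f" "\<And>s. c s \<in> S1xS2" "(c has_vector_derivative v) (at t)"
  shows "((\<lambda>s. f (c s)) has_vector_derivative
     frechet_derivative f (at (c t) within S1xS2) v) (at t)"
proof -
  have "(f has_derivative frechet_derivative f (at (c t) within S1xS2)) (at (c t) within S1xS2)"
    using assms smooth_map_on_imp_differentiable_within[of S1xS2 f "c t"]
    by (simp add: diffeomorphism_def frechet_derivative_works)
  then have D: "(f has_derivative frechet_derivative f (at (c t) within S1xS2)) (at (c t) within range c)"
    by (rule has_derivative_subset) (use assms in auto)
  have "((\<lambda>s. f (c s)) has_derivative
     (\<lambda>h. frechet_derivative f (at (c t) within S1xS2) (h *\<^sub>R v))) (at t)"
    using has_derivative_in_compose[OF assms(3)[unfolded has_vector_derivative_def] D] .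
  then show ?thesis
    by (simp add: has_vector_derivative_def linear_scale[OF has_derivative_linear[OF D]])
qed

lemma conformal_inv:
  assumes f: "diffeomorphism f" and "conformal f \<kappa>"
  shows "conformal (inv f) (\<lambda>m. 1 / \<kappa> (inv f m))"
  unfolding conformal_def
proof (intro conjI ballI allI impI)
  note f' = diffeomorphism_inv[OF f]
  show "1 / \<kappa> (inv f m) > 0" if "m \<in> S1xS2" for m
    using assms that diffeomorphism_mem[OF f'] by (auto simp: conformal_def)
  fix c t v assume c: "(\<forall>s. c s \<in> S1xS2) \<and> (c has_vector_derivative v) (at t)"
  obtain w where w: "((\<lambda>s. inv f (c s)) has_vector_derivative w) (at t)"
    using diffeomorphism_along_curve[OF f'] c by blast
  then obtain v' where v': "((\<lambda>s. f (inv f (c s))) has_vector_derivative v') (at t)"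
    "contact_form (f (inv f (c t))) v' = \<kappa> (inv f (c t)) * contact_form (inv f (c t)) w"
    using conformalD[OF assms(2), of "\<lambda>s. inv f (c s)"] c diffeomorphism_mem[OF f'] by blast
  \<comment> \<open>The curve \<open>f (inv f (c s))\<close> is \<open>c\<close> itself, so the
    relation for \<open>f\<close> along \<open>inv f (c s)\<close> can be solved for the form
    evaluated on \<open>w\<close>.\<close>
  have "v' = v"
    using v'(1) c vector_derivative_unique_at by (fastforce simp: diffeomorphism_inverses[OF f])
  moreover have "\<kappa> (inv f (c t)) > 0"
    using assms c diffeomorphism_mem[OF f'] by (auto simp: conformal_def)
  ultimately have "contact_form (inv f (c t)) w = 1 / \<kappa> (inv f (c t)) * contact_form (c t) v"
    using v'(2) by (simp add: diffeomorphism_inverses[OF f])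
  with w show "\<exists>w. ((\<lambda>s. inv f (c s)) has_vector_derivative w) (at t) \<and>
      contact_form (inv f (c t)) w = 1 / \<kappa> (inv f (c t)) * contact_form (c t) v" by blast
qed

lemma conformal_comp:
  assumes "diffeomorphism g" "conformal f \<kappa>" "conformal g \<mu>"
  shows "conformal (f \<circ> g) (\<lambda>m. \<kappa> (g m) * \<mu> m)"
  unfolding conformal_def
proof (intro conjI ballI allI impI)
  note g = diffeomorphism_mem[OF assms(1)]
  show "\<kappa> (g m) * \<mu> m > 0" if "m \<in> S1xS2" for m
    using assms that g by (auto simp: conformal_def)
  fix c t v assume c: "(\<forall>s. c s \<in> S1xS2) \<and> (c has_vector_derivative v) (at t)"
  then obtain w where w: "((\<lambda>s. g (c s)) has_vector_derivative w) (at t)"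
    "contact_form (g (c t)) w = \<mu> (c t) * contact_form (c t) v"
    using conformalD[OF assms(3), of c] by blast
  then obtain x where "((\<lambda>s. f (g (c s))) has_vector_derivative x) (at t)"
    "contact_form (f (g (c t))) x = \<kappa> (g (c t)) * contact_form (g (c t)) w"
    using conformalD[OF assms(2), of "\<lambda>s. g (c s)"] c g by blast
  with w show "\<exists>w. ((\<lambda>s. (f \<circ> g) (c s)) has_vector_derivative w) (at t) \<and>
      contact_form ((f \<circ> g) (c t)) w = \<kappa> (g (c t)) * \<mu> (c t) * contact_form (c t) v"
    unfolding comp_def mult.assoc by metis
qed

lemma contact_symmetry_comp:
  "contact_symmetry f \<Longrightarrow> contact_symmetry g \<Longrightarrow> contact_symmetry (f \<circ> g)"
  unfolding contact_symmetry_def using diffeomorphism_comp conformal_comp by blast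

lemma contact_symmetry_inv: "contact_symmetry f \<Longrightarrow> contact_symmetry (inv f)"
  unfolding contact_symmetry_def using diffeomorphism_inv conformal_inv by blast

lemma contact_symmetry_derivative_subset:
  assumes "contact_symmetry f" "m \<in> S1xS2"
  shows "frechet_derivative f (at m within S1xS2) ` contact_structure m \<subseteq> contact_structure (f m)"
proof (rule image_subsetI)
  fix v assume v: "v \<in> contact_structure m"
  then obtain c where c: "\<And>t. c t \<in> S1xS2" "c 0 = m" "(c has_vector_derivative v) (at 0)"
    using assms(2) curve_in_S1xS2[of m v] by (auto simp: contact_structure_def)
  obtain \<kappa> where f: "diffeomorphism f" "conformal f \<kappa>"
    using assms(1) by (auto simp: contact_symmetry_def)
  let ?w = "frechet_derivative f (at m within S1xS2) v"
  have w: "((\<lambda>s. f (c s)) has_vector_derivative ?w) (at 0)"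
    using diffeomorphism_along_curve[OF f(1) c(1,3)] c(2) by simp
  obtain w' where w': "((\<lambda>s. f (c s)) has_vector_derivative w') (at 0)"
    "contact_form (f (c 0)) w' = \<kappa> (c 0) * contact_form (c 0) v"
    using conformalD[OF f(2) c(1,3)] by blast
  have "w' = ?w" using w w'(1) vector_derivative_unique_at by blast
  moreover have "?w \<in> tangent_S1xS2 (f m)"
    using tangent_of_curve[OF _ w] c diffeomorphism_mem[OF f(1)] by auto
  ultimately show "?w \<in> contact_structure (f m)"
    using w'(2) v c(2) by (simp add: contact_structure_def)
qed

text \<open>The inclusion just proved also holds for \<open>inv f\<close> and supplies a candidate
  preimage of each \<open>w\<close>. That the derivative of \<open>f\<close> sends it back to
  \<open>w\<close> is seen on a curve with velocity \<open>w\<close>.\<close>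

lemma contact_symmetry_imp_contactomorphism:
  assumes "contact_symmetry f"
  shows "f \<in> contactomorphisms"
proof -
  have f: "diffeomorphism f" using assms by (simp add: contact_symmetry_def)
  have "contact_structure (f m) \<subseteq> frechet_derivative f (at m within S1xS2) ` contact_structure m"
    if m: "m \<in> S1xS2" for m
  proof
    note f' = diffeomorphism_inv[OF f]
    have fm: "f m \<in> S1xS2" and inv: "inv f (f m) = m"
      using m by (simp_all add: diffeomorphism_mem[OF f] diffeomorphism_inverses[OF f])
    fix w assume w: "w \<in> contact_structure (f m)"
    let ?v = "frechet_derivative (inv f) (at (f m) within S1xS2) w"
    have "?v \<in> contact_structure m"
      using contact_symmetry_derivative_subset[OF contact_symmetry_inv[OF assms] fm] w inv by auto
    moreover have "frechet_derivative f (at m within S1xS2) ?v = w"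
    proof -
      obtain c where c: "\<And>t. c t \<in> S1xS2" "c 0 = f m" "(c has_vector_derivative w) (at 0)"
        using fm w curve_in_S1xS2[of "f m" w] by (auto simp: contact_structure_def)
      have "((\<lambda>s. inv f (c s)) has_vector_derivative ?v) (at 0)"
        using diffeomorphism_along_curve[OF f' c(1,3)] c(2) by simp
      then have "((\<lambda>s. f (inv f (c s))) has_vector_derivative
          frechet_derivative f (at m within S1xS2) ?v) (at 0)"
        using diffeomorphism_along_curve[OF f, of "\<lambda>s. inv f (c s)" ?v 0] c inv
          diffeomorphism_mem[OF f'] by simp
      then show ?thesis
        using c(3) vector_derivative_unique_at by (fastforce simp: diffeomorphism_inverses[OF f])
    qed
    ultimately show "w \<in> frechet_derivative f (at m within S1xS2) ` contact_structure m"
      by (metis imageI)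
  qed
  then show ?thesis
    using f contact_symmetry_derivative_subset[OF assms] by (fastforce simp: contactomorphisms_def)
qed

text \<open>The formulas below make sense on all of the ambient space or on parts of it; this
  normalises them to the representation of self-maps by permutations of
  \<open>S1xS2\<close>.\<close>

definition extend :: "(ambient \<Rightarrow> ambient) \<Rightarrow> ambient \<Rightarrow> ambient" where
  "extend f m = (if m \<in> S1xS2 then f m else m)"

lemma extend_diffeomorphism:
  assumes "\<And>m. m \<in> S1xS2 \<Longrightarrow> f m \<in> S1xS2" "\<And>m. m \<in> S1xS2 \<Longrightarrow> g m \<in> S1xS2"
    and "\<And>m. m \<in> S1xS2 \<Longrightarrow> g (f m) = m" "\<And>m. m \<in> S1xS2 \<Longrightarrow> f (g m) = m"
    and "smooth_map_on S1xS2 f" "smooth_map_on S1xS2 g"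
  shows "diffeomorphism (extend f)" and "inv (extend f) = extend g"
proof -
  have "extend f \<circ> extend g = id" "extend g \<circ> extend f = id"
    using assms(1-4) by (auto simp: extend_def)
  then show inv: "inv (extend f) = extend g" by (rule inv_unique_comp)
  have "bij (extend f)"
    using \<open>extend f \<circ> extend g = id\<close> \<open>extend g \<circ> extend f = id\<close> o_bij by blast
  then have "extend f permutes S1xS2"
    by (simp add: permutes_def bij_iff extend_def)
  moreover have "smooth_map_on S1xS2 (extend f)" "smooth_map_on S1xS2 (extend g)"
    using assms(5,6) smooth_map_on_cong[of S1xS2 f "extend f"] smooth_map_on_cong[of S1xS2 g "extend g"]
    by (auto simp: extend_def)
  ultimately show "diffeomorphism (extend f)" by (simp add: diffeomorphism_def inv)
qed

lemma conformal_extend: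
  assumes "conformal f \<kappa>"
  shows "conformal (extend f) \<kappa>"
  using assms unfolding conformal_def extend_def by auto

text \<open>\<open>Im (cnj W * W')\<close> is the squared modulus times the angular velocity, and
  multiplication by \<open>cis a\<close> adds a' to the latter. Only this imaginary part enters the
  contact form, hence the shape of the conclusion.\<close>

lemma phase_shift_derivative:
  assumes "(W has_vector_derivative W') (at t)" "(a has_real_derivative a') (at t)"
  obtains V where "((\<lambda>s. W s * cis (a s)) has_vector_derivative V) (at t)"
    "Im (cnj (W t * cis (a t)) * V) = Im (cnj (W t) * W') + (cmod (W t))\<^sup>2 * a'"
proof
  have "((\<lambda>s. cis (a s)) has_vector_derivative a' *\<^sub>R (\<i> * cis (a t))) (at t)"
    using has_derivative_cis[OF assms(2)[unfolded has_field_derivative_def]]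
    by (simp add: has_vector_derivative_def algebra_simps)
  then show "((\<lambda>s. W s * cis (a s)) has_vector_derivative
      (W t * a' *\<^sub>R (\<i> * cis (a t)) + W' * cis (a t))) (at t)"
    by (rule has_vector_derivative_mult[OF assms(1)])
  have "cnj (W t * cis (a t)) * (W t * a' *\<^sub>R (\<i> * cis (a t)) + W' * cis (a t)) =
      (cnj (cis (a t)) * cis (a t)) * (cnj (W t) * W' + (W t * cnj (W t)) * (a' *\<^sub>R \<i>))"
    by (simp add: algebra_simps scaleR_conv_of_real)
  also have "\<dots> = cnj (W t) * W' + of_real ((cmod (W t))\<^sup>2) * (a' *\<^sub>R \<i>)"
    unfolding complex_norm_square[symmetric] by (simp add: cis_cnj cis_mult)
  finally show "Im (cnj (W t * cis (a t)) * (W t * a' *\<^sub>R (\<i> * cis (a t)) + W' * cis (a t))) =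
      Im (cnj (W t) * W') + (cmod (W t))\<^sup>2 * a'"
    by simp
qed

text \<open>The radial term r r' |W|^2 is real and drops out of the imaginary part.\<close>

lemma scaled_derivative:
  assumes "(W has_vector_derivative W') (at t)" "(r has_real_derivative r') (at t)"
  obtains V where "((\<lambda>s. r s *\<^sub>R W s) has_vector_derivative V) (at t)"
    "Im (cnj (r t *\<^sub>R W t) * V) = (r t)\<^sup>2 * Im (cnj (W t) * W')"
proof
  show "((\<lambda>s. r s *\<^sub>R W s) has_vector_derivative (r t *\<^sub>R W' + r' *\<^sub>R W t)) (at t)"
    using has_vector_derivative_scaleR[OF assms(2,1)] .
  show "Im (cnj (r t *\<^sub>R W t) * (r t *\<^sub>R W' + r' *\<^sub>R W t)) = (r t)\<^sup>2 * Im (cnj (W t) * W')"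
    by (simp add: algebra_simps power2_eq_square)
qed

lemma norm_square_derivative:
  fixes W :: "real \<Rightarrow> complex"
  assumes "(W has_vector_derivative W') (at t)"
  obtains v' where "((\<lambda>s. (cmod (W s))\<^sup>2) has_real_derivative v') (at t)"
proof
  show "((\<lambda>s. (cmod (W s))\<^sup>2) has_real_derivative (W t \<bullet> W' + W' \<bullet> W t)) (at t)"
    using bounded_bilinear.has_vector_derivative[OF bounded_bilinear_inner assms assms]
    by (simp add: has_real_derivative_iff_has_vector_derivative power2_norm_eq_inner)
qed

lemma has_vector_derivative_cong_nhds:
  assumes "(f has_vector_derivative D) (at t)" "\<forall>\<^sub>F s in nhds t. f s = g s"
  shows "(g has_vector_derivative D) (at t)"
proof -
  obtain S where "open S" "t \<in> S" "\<And>s. s \<in> S \<Longrightarrow> f s = g s"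
    using assms(2) by (auto simp: eventually_nhds)
  then show ?thesis using has_vector_derivative_transform_within_open[OF assms(1)] by blast
qed

section \<open>Rotations of the circle and of the (x, y)-plane\<close>

definition rotation :: "real \<Rightarrow> real \<Rightarrow> ambient \<Rightarrow> ambient" where
  "rotation a b m = point (fst m * cis a) (planar m * cis b) (height m)"

lemma rotation_simps [simp]:
  "fst (rotation a b m) = fst m * cis a" "planar (rotation a b m) = planar m * cis b"
  "height (rotation a b m) = height m"
  by (simp_all add: rotation_def)

lemma rotation_in_S1xS2 [simp]: "rotation a b m \<in> S1xS2 \<longleftrightarrow> m \<in> S1xS2"
  by (simp add: S1xS2_iff norm_mult)

lemma rotation_rotation: "rotation a b (rotation c d m) = rotation (a + c) (b + d) m"
  by (rule ambient_eqI) (simp_all add: mult.assoc cis_mult add.commute)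

lemma rotation_0 [simp]: "rotation 0 0 m = m"
  by (rule ambient_eqI) simp_all

lemma smooth_on_open_rotation:
  assumes "smooth_on_open U a" "smooth_on_open U b" "smooth_on_open U f"
  shows "smooth_on_open U (\<lambda>x. rotation (a x) (b x) (f x))"
  unfolding rotation_def
  by (intro smooth_on_open_point smooth_on_open_mult smooth_on_open_cis assms
      smooth_on_open_linear[OF bounded_linear_fst] smooth_on_open_linear[OF bounded_linear_planar]
      smooth_on_open_linear[OF bounded_linear_height])

text \<open>The angles may depend on time, which gives two facts at once: constant angles preserve
  the contact form, and moving angles add the Hamiltonians z of the circle rotation and x^2 + y^2 of
  the plane rotation.\<close>

lemma rotation_derivative:
  assumes "\<And>s. c s \<in> S1xS2" "(c has_vector_derivative v) (at t)"
    and "(a has_real_derivative a') (at t)" "(b has_real_derivative b') (at t)"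
  obtains w where "((\<lambda>s. rotation (a s) (b s) (c s)) has_vector_derivative w) (at t)"
    "contact_form (rotation (a t) (b t) (c t)) w =
       contact_form (c t) v + a' * height (c t) + b' * (cmod (planar (c t)))\<^sup>2"
proof -
  note d = has_vector_derivative_components[OF assms(2)]
  obtain V where V: "((\<lambda>s. fst (c s) * cis (a s)) has_vector_derivative V) (at t)"
    "Im (cnj (fst (c t) * cis (a t)) * V) = Im (cnj (fst (c t)) * fst v) + (cmod (fst (c t)))\<^sup>2 * a'"
    using phase_shift_derivative[OF d(1) assms(3)] by blast
  obtain W where W: "((\<lambda>s. planar (c s) * cis (b s)) has_vector_derivative W) (at t)"
    "Im (cnj (planar (c t) * cis (b t)) * W) =
       Im (cnj (planar (c t)) * planar v) + (cmod (planar (c t)))\<^sup>2 * b'"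
    using phase_shift_derivative[OF d(2) assms(4)] by blast
  have "cmod (fst (c t)) = 1" using assms(1) by (simp add: S1xS2_iff)
  then have "contact_form (rotation (a t) (b t) (c t)) (point V W (height v)) =
       contact_form (c t) v + a' * height (c t) + b' * (cmod (planar (c t)))\<^sup>2"
    unfolding contact_form_eq rotation_simps point_simps V(2) W(2) by (simp add: algebra_simps)
  moreover have "((\<lambda>s. rotation (a s) (b s) (c s)) has_vector_derivative point V W (height v)) (at t)"
    unfolding rotation_def using has_vector_derivative_point[OF V(1) W(1) d(3)] .
  ultimately show ?thesis by (rule that[rotated])
qed

lemma contact_symmetry_rotation: "contact_symmetry (extend (rotation a b))"
proof -
  have "smooth_map_on S1xS2 (rotation a b)" for a b
    by (rule smooth_map_on_smooth_on_open[OF smooth_on_open_rotation[of UNIV "\<lambda>_. a" "\<lambda>_. b" "\<lambda>m. m"]])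
      (auto intro: smooth_on_open_const smooth_on_open_bounded_linear)
  then have "diffeomorphism (extend (rotation a b))"
    by (intro extend_diffeomorphism(1)[of _ "rotation (- a) (- b)"]) (simp_all add: rotation_rotation)
  moreover have "conformal (rotation a b) (\<lambda>_. 1)"
    unfolding conformal_def
  proof (intro conjI ballI allI impI)
    fix c t v assume c: "(\<forall>s. c s \<in> S1xS2) \<and> (c has_vector_derivative v) (at t)"
    obtain w where "((\<lambda>s. rotation a b (c s)) has_vector_derivative w) (at t)"
      "contact_form (rotation a b (c t)) w =
         contact_form (c t) v + 0 * height (c t) + 0 * (cmod (planar (c t)))\<^sup>2"
      using rotation_derivative[of c v t "\<lambda>_. a" 0 "\<lambda>_. b" 0] c by (auto simp del: mult_zero_left)
    then show "\<exists>w. ((\<lambda>s. rotation a b (c s)) has_vector_derivative w) (at t) \<and>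
        contact_form (rotation a b (c t)) w = 1 * contact_form (c t) v"
      by (metis add.right_neutral mult_1 mult_zero_left)
  qed simp
  ultimately show ?thesis using conformal_extend by (auto simp: contact_symmetry_def)
qed

subsection \<open>A contactomorphism displacing the south circle\<close>

text \<open>On the region \<open>z < 0\<close> put \<open>W = (x + \<i> y) / sqrt (- z)\<close>. Then
  \<open>z d\<theta> + x dy - y dx = z (d\<theta> - Im (cnj W dW))\<close>. With \<open>\<zeta> = W - 1\<close>, \<open>v = \<bar>\<zeta>\<bar>\<^sup>2\<close>, the twist rotates \<open>\<zeta>\<close>
  to \<open>\<zeta>\<^sub>1\<close> by an angle \<open>\<chi>(v)\<close> that vanishes for \<open>v \<ge> 2\<close>; it preserves \<open>d\<theta> - Im (cnj W dW)\<close> if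
  \<open>\<theta>\<close> is shifted by \<open>Im (\<zeta>\<^sub>1 - \<zeta>) + s(v)\<close> with \<open>s' = v \<chi>'\<close>. Taking \<open>\<chi> = B'\<close> and \<open>s = v B' - B\<close> with
  \<open>B(v) = - \<sigma> exp (- 1 / (2 - v))\<close> gives a compactly supported solution.\<close>

definition twist_angle :: "real \<Rightarrow> complex \<Rightarrow> real" where
  "twist_angle \<sigma> W = \<sigma> * flat 2 (2 - (cmod (W - 1))\<^sup>2)"

text \<open>For B as above, B' is \<sigma> \<open>flat 2\<close> and -B is \<sigma>
  \<open>flat 0\<close>, both at 2 - v. The cutoff 2 exceeds the value v = 1 at W = 0, so that the
  south circle lies inside the support.\<close>

definition twist_shift :: "real \<Rightarrow> complex \<Rightarrow> real" where
  "twist_shift \<sigma> W = \<sigma> * ((cmod (W - 1))\<^sup>2 * flat 2 (2 - (cmod (W - 1))\<^sup>2) + flat 0 (2 - (cmod (W - 1))\<^sup>2))"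

definition twist_disc :: "real \<Rightarrow> complex \<Rightarrow> complex" where
  "twist_disc \<sigma> W = 1 + (W - 1) * cis (twist_angle \<sigma> W)"

definition twist_phase :: "real \<Rightarrow> complex \<Rightarrow> real" where
  "twist_phase \<sigma> W = Im (twist_disc \<sigma> W - W) + twist_shift \<sigma> W"

text \<open>Angle and shift depend on W only through |W - 1|, which the twist preserves, and are odd
  in \<sigma>. The remaining part of the phase is a difference of end points, which changes sign
  when they are exchanged.\<close>

lemma twist_inverse:
  "twist_disc (- \<sigma>) (twist_disc \<sigma> W) = W"
  "twist_phase (- \<sigma>) (twist_disc \<sigma> W) = - twist_phase \<sigma> W"
proof -
  have r: "cmod (twist_disc \<sigma> W - 1) = cmod (W - 1)"
    by (simp add: twist_disc_def norm_mult)
  then have "twist_angle (- \<sigma>) (twist_disc \<sigma> W) = - twist_angle \<sigma> W"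
    "twist_shift (- \<sigma>) (twist_disc \<sigma> W) = - twist_shift \<sigma> W"
    by (simp_all add: twist_angle_def twist_shift_def)
  then show 1: "twist_disc (- \<sigma>) (twist_disc \<sigma> W) = W"
    by (simp add: twist_disc_def[of "- \<sigma>"]) (simp add: twist_disc_def mult.assoc cis_mult)
  show "twist_phase (- \<sigma>) (twist_disc \<sigma> W) = - twist_phase \<sigma> W"
    unfolding twist_phase_def 1 using \<open>twist_shift (- \<sigma>) _ = _\<close> by simp
qed

lemma twist_derivative:
  assumes "(u has_vector_derivative u') (at t)" "(W has_vector_derivative W') (at t)" "cmod (u t) = 1"
  obtains u1 W1 where "((\<lambda>s. u s * cis (twist_phase \<sigma> (W s))) has_vector_derivative u1) (at t)"
    "((\<lambda>s. twist_disc \<sigma> (W s)) has_vector_derivative W1) (at t)"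
    "Im (cnj (u t * cis (twist_phase \<sigma> (W t))) * u1) - Im (cnj (twist_disc \<sigma> (W t)) * W1) =
     Im (cnj (u t) * u') - Im (cnj (W t) * W')"
proof -
  define v where "v s = (cmod (W s - 1))\<^sup>2" for s
  have Z: "((\<lambda>s. W s - 1) has_vector_derivative W') (at t)"
    using assms(2) by (auto intro!: derivative_eq_intros)
  then obtain v' where v: "(v has_real_derivative v') (at t)"
    unfolding v_def by (rule norm_square_derivative)
  have flat: "((\<lambda>s. flat k (2 - v s)) has_real_derivative
      (flat (k + 2) (2 - v t) - k * flat (Suc k) (2 - v t)) * (- v')) (at t)" for k
    by (rule DERIV_chain2[OF flat_has_real_derivative]) (use v in \<open>auto intro!: derivative_eq_intros\<close>)
  define \<chi>' where "\<chi>' = \<sigma> * ((flat 4 (2 - v t) - 2 * flat 3 (2 - v t)) * (- v'))"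
  have angle: "((\<lambda>s. twist_angle \<sigma> (W s)) has_real_derivative \<chi>') (at t)"
    unfolding twist_angle_def v_def[symmetric] \<chi>'_def
    using DERIV_cmult[OF flat[of 2], of \<sigma>] by (simp add: numeral_eq_Suc)
  \<comment> \<open>The term v' B' from the product rule cancels against the derivative of -B,
    leaving v \<chi>'.\<close>
  have shift: "((\<lambda>s. twist_shift \<sigma> (W s)) has_real_derivative v t * \<chi>') (at t)"
    unfolding twist_shift_def v_def[symmetric]
  proof (rule DERIV_cong)
    show "((\<lambda>s. \<sigma> * (v s * flat 2 (2 - v s) + flat 0 (2 - v s))) has_real_derivative
       \<sigma> * ((v' * flat 2 (2 - v t) + (flat (2 + 2) (2 - v t) - real 2 * flat (Suc 2) (2 - v t)) * (- v') * v t)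
         + (flat (0 + 2) (2 - v t) - real 0 * flat (Suc 0) (2 - v t)) * (- v'))) (at t)"
      by (intro DERIV_cmult DERIV_add DERIV_mult v flat)
  qed (simp add: \<chi>'_def numeral_eq_Suc algebra_simps)
  obtain Z1 where Z1: "((\<lambda>s. (W s - 1) * cis (twist_angle \<sigma> (W s))) has_vector_derivative Z1) (at t)"
    "Im (cnj ((W t - 1) * cis (twist_angle \<sigma> (W t))) * Z1) = Im (cnj (W t - 1) * W') + v t * \<chi>'"
    using phase_shift_derivative[OF Z angle] unfolding v_def by blast
  have disc: "((\<lambda>s. twist_disc \<sigma> (W s)) has_vector_derivative Z1) (at t)"
    unfolding twist_disc_def using has_vector_derivative_add[OF has_vector_derivative_const Z1(1)] by simp
  have "((\<lambda>s. Im (twist_disc \<sigma> (W s) - W s)) has_real_derivative Im (Z1 - W')) (at t)"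
    using bounded_linear.has_vector_derivative[OF bounded_linear_Im has_vector_derivative_diff[OF disc assms(2)]]
    by (simp add: has_real_derivative_iff_has_vector_derivative)
  then have "((\<lambda>s. twist_phase \<sigma> (W s)) has_real_derivative (Im (Z1 - W') + v t * \<chi>')) (at t)"
    unfolding twist_phase_def by (intro DERIV_add shift)
  then obtain u1 where u1: "((\<lambda>s. u s * cis (twist_phase \<sigma> (W s))) has_vector_derivative u1) (at t)"
    "Im (cnj (u t * cis (twist_phase \<sigma> (W t))) * u1) =
       Im (cnj (u t) * u') + (cmod (u t))\<^sup>2 * (Im (Z1 - W') + v t * \<chi>')"
    using phase_shift_derivative[OF assms(1)] by blast
  \<comment> \<open>The centre 1 of the rotation contributes Im Z1, and likewise Im W' before the
    twist; the term Im (Z1 - W') in the phase compensates for both.\<close>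
  have "Im (cnj (twist_disc \<sigma> (W t)) * Z1) = Im (cnj (W t - 1) * W') + v t * \<chi>' + Im Z1"
    using Z1(2) by (simp add: twist_disc_def algebra_simps)
  then have "Im (cnj (u t * cis (twist_phase \<sigma> (W t))) * u1) - Im (cnj (twist_disc \<sigma> (W t)) * Z1) =
     Im (cnj (u t) * u') - Im (cnj (W t) * W')"
    unfolding u1(2) using assms(3) by (simp add: algebra_simps)
  with u1(1) disc show ?thesis by (rule that)
qed

section \<open>Coordinates on the region z < 0\<close>

definition plane :: "ambient \<Rightarrow> complex" where
  "plane m = (1 / sqrt (- height m)) *\<^sub>R planar m"

text \<open>The solution \<open>w = - z > 0\<close> of \<open>\<bar>W\<bar>\<^sup>2 = (1 - z\<^sup>2) / (- z) = 1 / w - w\<close>.\<close>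

definition depth :: "complex \<Rightarrow> real" where
  "depth W = (sqrt (((cmod W)\<^sup>2)\<^sup>2 + 4) - (cmod W)\<^sup>2) / 2"

text \<open>Inverse of the coordinates \<open>fst\<close> and \<open>plane\<close>. As
  \<open>depth W\<close> is positive for every W, the region z < 0 corresponds to the whole of S^1
  times the complex plane, and the twist can be defined there without restricting W.\<close>

definition from_plane :: "complex \<Rightarrow> complex \<Rightarrow> ambient" where
  "from_plane u W = point u (sqrt (depth W) *\<^sub>R W) (- depth W)"

lemma depth_pos: "depth W > 0"
proof -
  have "sqrt (((cmod W)\<^sup>2)\<^sup>2) < sqrt (((cmod W)\<^sup>2)\<^sup>2 + 4)" by (intro real_sqrt_less_mono) simp
  then show ?thesis unfolding real_sqrt_abs depth_def by simp
qed

lemma depth_eq: "(depth W)\<^sup>2 + (cmod W)\<^sup>2 * depth W = 1"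
proof -
  have "(sqrt (((cmod W)\<^sup>2)\<^sup>2 + 4))\<^sup>2 = ((cmod W)\<^sup>2)\<^sup>2 + 4" by simp
  then show ?thesis by (simp add: depth_def power2_eq_square field_simps)
qed

lemma depth_unique:
  assumes "w > 0" "w\<^sup>2 + (cmod W)\<^sup>2 * w = 1"
  shows "depth W = w"
proof -
  have "(depth W - w) * (depth W + w + (cmod W)\<^sup>2) = 0"
    using depth_eq[of W] assms(2) by (simp add: power2_eq_square algebra_simps)
  moreover have "depth W + w + (cmod W)\<^sup>2 > 0"
    using depth_pos[of W] assms(1) by (simp add: add_pos_nonneg)
  ultimately show ?thesis by auto
qed

lemma from_plane_simps [simp]:
  "fst (from_plane u W) = u" "height (from_plane u W) = - depth W" "plane (from_plane u W) = W"
  "planar (from_plane u W) = sqrt (depth W) *\<^sub>R W"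
  using depth_pos[of W] by (simp_all add: from_plane_def plane_def)

lemma from_plane_in_S1xS2:
  assumes "cmod u = 1"
  shows "from_plane u W \<in> S1xS2"
  using depth_eq[of W] depth_pos[of W] assms
  by (simp add: S1xS2_iff power_mult_distrib algebra_simps)

lemma planar_norm:
  assumes "m \<in> S1xS2" "height m < 0"
  shows "(cmod (planar m))\<^sup>2 = - height m * (cmod (plane m))\<^sup>2"
  using assms by (simp add: plane_def power_divide power_mult_distrib)

lemma depth_plane:
  assumes "m \<in> S1xS2" "height m < 0"
  shows "depth (plane m) = - height m"
  using assms planar_norm[OF assms] by (intro depth_unique) (auto simp: S1xS2_iff algebra_simps)

lemma from_plane_plane:
  assumes "m \<in> S1xS2" "height m < 0"
  shows "from_plane (fst m) (plane m) = m"
proof -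
  have "sqrt (- height m) *\<^sub>R plane m = planar m" using assms by (simp add: plane_def)
  with assms show ?thesis by (intro ambient_eqI) (simp_all add: depth_plane)
qed

text \<open>Scaling by 1 / sqrt (-z) divides Im (cnj w dw) by -z, so z can be factored out of the
  whole form.\<close>

lemma plane_derivative:
  assumes "height (c t) < 0" "(c has_vector_derivative v) (at t)"
  obtains W' where "((\<lambda>s. plane (c s)) has_vector_derivative W') (at t)"
    "contact_form (c t) v = height (c t) * (Im (cnj (fst (c t)) * fst v) - Im (cnj (plane (c t)) * W'))"
proof -
  note d = has_vector_derivative_components[OF assms(2)]
  have h: "((\<lambda>s. height (c s)) has_real_derivative height v) (at t)"
    using d(3) by (simp add: has_real_derivative_iff_has_vector_derivative)
  then obtain r' where "((\<lambda>s. 1 / sqrt (- height (c s))) has_real_derivative r') (at t)"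
  proof -
    have "((\<lambda>s. sqrt (- height (c s))) has_real_derivative
        (inverse (sqrt (- height (c t))) / 2) * (- height v)) (at t)"
      by (rule DERIV_chain2[OF DERIV_real_sqrt]) (use assms(1) h in \<open>auto intro!: derivative_eq_intros\<close>)
    from DERIV_inverse_fun[OF this] assms(1) that show ?thesis
      by (auto simp: inverse_eq_divide)
  qed
  then obtain W' where W': "((\<lambda>s. plane (c s)) has_vector_derivative W') (at t)"
    "Im (cnj (plane (c t)) * W') = (1 / sqrt (- height (c t)))\<^sup>2 * Im (cnj (planar (c t)) * planar v)"
    unfolding plane_def using scaled_derivative[OF d(2)] by blast
  then have "contact_form (c t) v =
      height (c t) * (Im (cnj (fst (c t)) * fst v) - Im (cnj (plane (c t)) * W'))"
    using assms(1) by (simp add: contact_form_eq power_divide field_simps)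
  with W'(1) show ?thesis by (rule that)
qed

lemma from_plane_derivative:
  assumes "(u has_vector_derivative u') (at t)" "(W has_vector_derivative W') (at t)"
  obtains v where "((\<lambda>s. from_plane (u s) (W s)) has_vector_derivative v) (at t)"
    "contact_form (from_plane (u t) (W t)) v =
       - depth (W t) * (Im (cnj (u t) * u') - Im (cnj (W t) * W'))"
proof -
  obtain a where a: "((\<lambda>s. (cmod (W s))\<^sup>2) has_real_derivative a) (at t)"
    using norm_square_derivative[OF assms(2)] by blast
  have pos: "((cmod (W t))\<^sup>2)\<^sup>2 + 4 > 0" by (simp add: add_nonneg_pos)
  obtain d' where d: "((\<lambda>s. depth (W s)) has_real_derivative d') (at t)"
  proof -
    note DERIV_chain2[where f = sqrt, OF DERIV_real_sqrt[OF pos]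
        DERIV_add[OF DERIV_power[OF a, of 2] DERIV_const[of 4]]]
    from DERIV_cdivide[OF DERIV_diff[OF this a]] that show ?thesis
      unfolding depth_def by blast
  qed
  then obtain r' where "((\<lambda>s. sqrt (depth (W s))) has_real_derivative r') (at t)"
    using DERIV_chain2[where f = sqrt, OF DERIV_real_sqrt[OF depth_pos[of "W t"]] d] by blast
  then obtain w where w: "((\<lambda>s. sqrt (depth (W s)) *\<^sub>R W s) has_vector_derivative w) (at t)"
    "Im (cnj (sqrt (depth (W t)) *\<^sub>R W t) * w) = (sqrt (depth (W t)))\<^sup>2 * Im (cnj (W t) * W')"
    using scaled_derivative[OF assms(2)] by blast
  have "((\<lambda>s. - depth (W s)) has_vector_derivative - d') (at t)"
    using DERIV_minus[OF d] by (simp add: has_real_derivative_iff_has_vector_derivative)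
  then have "((\<lambda>s. from_plane (u s) (W s)) has_vector_derivative point u' w (- d')) (at t)"
    unfolding from_plane_def by (intro has_vector_derivative_point assms w)
  moreover have "contact_form (from_plane (u t) (W t)) (point u' w (- d')) =
       - depth (W t) * (Im (cnj (u t) * u') - Im (cnj (W t) * W'))"
    using w(2) depth_pos[of "W t"] by (simp add: contact_form_eq algebra_simps del: complex_cnj_scaleR)
  ultimately show ?thesis by (rule that)
qed

section \<open>The twist as a contactomorphism of the manifold\<close>

definition twist :: "real \<Rightarrow> ambient \<Rightarrow> ambient" where
  "twist \<sigma> m = (if height m < 0
     then from_plane (fst m * cis (twist_phase \<sigma> (plane m))) (twist_disc \<sigma> (plane m)) else m)"

lemma twist_in_S1xS2: "m \<in> S1xS2 \<Longrightarrow> twist \<sigma> m \<in> S1xS2"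
  by (auto simp: twist_def norm_mult S1xS2_iff[of m] intro: from_plane_in_S1xS2)

lemma twist_twist:
  assumes "m \<in> S1xS2"
  shows "twist (- \<sigma>) (twist \<sigma> m) = m"
  using assms depth_pos
  by (auto simp: twist_def twist_inverse mult.assoc cis_mult from_plane_plane)

text \<open>As z tends to 0 from below, W escapes to infinity: for w = -z < 1/10 one has |W|^2 = 1/w
  - w > 9, hence |W - 1| > 2, well outside the support |W - 1|^2 < 2. This margin is what glues the
  twist to the identity.\<close>

lemma twist_trivial:
  assumes "m \<in> S1xS2" "height m > - 1 / 10"
  shows "twist \<sigma> m = m"
proof (cases "height m < 0")
  case True
  define w where "w = - height m"
  have w: "0 < w" "w < 1 / 10" using True assms by (auto simp: w_def)
  have "w\<^sup>2 + (cmod (plane m))\<^sup>2 * w = 1"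
    using depth_eq[of "plane m"] depth_plane[OF assms(1) True] by (simp add: w_def)
  moreover have "w\<^sup>2 < 1 / 10 * w" using w by (simp add: power2_eq_square)
  ultimately have "9 * w < (cmod (plane m))\<^sup>2 * w" using w by linarith
  then have "3\<^sup>2 < (cmod (plane m))\<^sup>2" using w by simp
  then have "3 < cmod (plane m)" by (rule power_less_imp_less_base) simp
  then have "2 < cmod (plane m - 1)" using norm_triangle_ineq2[of "plane m" 1] by simp
  then have "2\<^sup>2 < (cmod (plane m - 1))\<^sup>2" by (intro power_strict_mono) auto
  then show ?thesis
    using assms True by (simp add: twist_def twist_phase_def twist_disc_def twist_angle_def
        twist_shift_def flat_def from_plane_plane)
qed (simp add: twist_def)

lemma smooth_on_open_norm_square:
  fixes f :: "'a::euclidean_space \<Rightarrow> 'b::real_inner"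
  assumes "smooth_on_open U f"
  shows "smooth_on_open U (\<lambda>x. (norm (f x))\<^sup>2)"
  unfolding power2_norm_eq_inner
  by (rule smooth_on_open_bilinear[OF bounded_bilinear_inner assms assms])

lemma smooth_on_open_twist_disc:
  assumes "smooth_on_open U f"
  shows "smooth_on_open U (\<lambda>x. twist_disc \<sigma> (f x))"
proof -
  have c: "smooth_on_open U (\<lambda>x. c)" for c :: "'c::real_normed_vector"
    using assms smooth_on_open_const by (auto simp: smooth_on_open_def)
  show ?thesis
    unfolding twist_disc_def twist_angle_def
    by (intro smooth_on_open_add smooth_on_open_mult smooth_on_open_diff smooth_on_open_cis
        smooth_on_open_flat smooth_on_open_norm_square c assms)
qed

lemma open_height_less: "open {m. height m < a}" and open_height_greater: "open {m. height m > a}"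
  by (auto intro!: open_Collect_less continuous_intros
      bounded_linear.continuous_on[OF bounded_linear_height])

text \<open>Two overlapping open sets are used: the formula serves for z < 0 and the identity for z
  > -1/10. The second is a neighbourhood of the equator z = 0, where the definition by cases
  switches.\<close>

lemma smooth_map_on_twist: "smooth_map_on S1xS2 (twist \<sigma>)"
  unfolding smooth_map_on_def
proof
  fix p assume p: "p \<in> S1xS2"
  show "\<exists>U F. p \<in> U \<and> smooth_on_open U F \<and> (\<forall>q\<in>S1xS2 \<inter> U. F q = twist \<sigma> q)"
  proof (cases "height p < 0")
    case True
    define U where "U = {m. height m < 0}"
    have U: "open U" unfolding U_def by (rule open_height_less)
    note lin = smooth_on_open_bounded_linear[OF U]
    have "smooth_on_open U plane"
      unfolding plane_def
      by (intro smooth_on_open_scaleR smooth_on_open_divide smooth_on_open_sqrt smooth_on_open_uminus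
          smooth_on_open_const lin bounded_linear_height bounded_linear_planar U) (auto simp: U_def)
    note r = smooth_on_open_norm_square[OF smooth_on_open_diff[OF this smooth_on_open_const[OF U, of 1]]]
      and disc = smooth_on_open_twist_disc[OF this]
    then have phase: "smooth_on_open U (\<lambda>m. twist_phase \<sigma> (plane m))"
      unfolding twist_phase_def twist_shift_def
      by (intro smooth_on_open_add smooth_on_open_mult smooth_on_open_diff
          smooth_on_open_flat smooth_on_open_const U \<open>smooth_on_open U plane\<close> r
          smooth_on_open_linear[OF bounded_linear_Im])
    have n: "smooth_on_open U (\<lambda>m. (cmod (twist_disc \<sigma> (plane m)))\<^sup>2)"
      by (rule smooth_on_open_norm_square[OF disc])
    have depth: "smooth_on_open U (\<lambda>m. depth (twist_disc \<sigma> (plane m)))"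
      unfolding depth_def
      by (intro smooth_on_open_divide smooth_on_open_diff smooth_on_open_sqrt smooth_on_open_add
          smooth_on_open_power2 n smooth_on_open_const U) (auto simp: add_nonneg_pos)
    have "smooth_on_open U (\<lambda>m. from_plane (fst m * cis (twist_phase \<sigma> (plane m))) (twist_disc \<sigma> (plane m)))"
      unfolding from_plane_def
      by (intro smooth_on_open_point smooth_on_open_mult smooth_on_open_cis smooth_on_open_scaleR
          smooth_on_open_uminus smooth_on_open_sqrt depth depth_pos phase disc lin bounded_linear_fst)
    then show ?thesis
      using True by (intro exI[of _ U] exI conjI) (auto simp: U_def twist_def)
  next
    case False
    have "smooth_on_open {m. height m > - 1 / 10} (\<lambda>m. m)"
      by (intro smooth_on_open_bounded_linear open_height_greater bounded_linear_ident)
    then show ?thesis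
      using False by (intro exI[of _ "{m. height m > - 1 / 10}"] exI[of _ "\<lambda>m. m"])
        (auto simp: twist_trivial)
  qed
qed

text \<open>For z < 0 the form is z times d\<theta> - Im (cnj W dW). The twist preserves the second
  factor, so the form is multiplied by the ratio of the heights.\<close>

definition twist_factor :: "real \<Rightarrow> ambient \<Rightarrow> real" where
  "twist_factor \<sigma> m = (if height m < 0 then height (twist \<sigma> m) / height m else 1)"

lemma conformal_twist: "conformal (twist \<sigma>) (twist_factor \<sigma>)"
  unfolding conformal_def
proof (intro conjI ballI allI impI)
  show "twist_factor \<sigma> m > 0" if "m \<in> S1xS2" for m
    using depth_pos by (auto simp: twist_factor_def twist_def intro: divide_pos_neg)
  fix c t v assume c: "(\<forall>s. c s \<in> S1xS2) \<and> (c has_vector_derivative v) (at t)"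
  have cont: "continuous (at t) (\<lambda>s. height (c s))"
    using c has_vector_derivative_components(3) has_vector_derivative_continuous by blast
  show "\<exists>w. ((\<lambda>s. twist \<sigma> (c s)) has_vector_derivative w) (at t) \<and>
      contact_form (twist \<sigma> (c t)) w = twist_factor \<sigma> (c t) * contact_form (c t) v"
  proof (cases "height (c t) < 0")
    case True
    obtain W' where W': "((\<lambda>s. plane (c s)) has_vector_derivative W') (at t)"
      "contact_form (c t) v = height (c t) * (Im (cnj (fst (c t)) * fst v) - Im (cnj (plane (c t)) * W'))"
      using plane_derivative True c by blast
    have "cmod (fst (c t)) = 1" using c by (simp add: S1xS2_iff)
    then obtain u1 W1 where 1: "((\<lambda>s. fst (c s) * cis (twist_phase \<sigma> (plane (c s)))) has_vector_derivative u1) (at t)"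
      "((\<lambda>s. twist_disc \<sigma> (plane (c s))) has_vector_derivative W1) (at t)"
      "Im (cnj (fst (c t) * cis (twist_phase \<sigma> (plane (c t)))) * u1) - Im (cnj (twist_disc \<sigma> (plane (c t))) * W1) =
         Im (cnj (fst (c t)) * fst v) - Im (cnj (plane (c t)) * W')"
      using twist_derivative[OF has_vector_derivative_components(1) W'(1)] c by blast
    let ?F = "\<lambda>m. from_plane (fst m * cis (twist_phase \<sigma> (plane m))) (twist_disc \<sigma> (plane m))"
    obtain w where w: "((\<lambda>s. ?F (c s)) has_vector_derivative w) (at t)"
      "contact_form (?F (c t)) w = - depth (twist_disc \<sigma> (plane (c t))) *
         (Im (cnj (fst (c t)) * fst v) - Im (cnj (plane (c t)) * W'))"
      using from_plane_derivative[OF 1(1,2)] unfolding 1(3) by blast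
    have "\<forall>\<^sub>F s in nhds t. height (c s) < 0"
      using cont True by (simp add: order_tendstoD(2) isCont_def eventually_nhds_conv_at)
    then have "\<forall>\<^sub>F s in nhds t. ?F (c s) = twist \<sigma> (c s)"
      by eventually_elim (simp add: twist_def)
    then have "((\<lambda>s. twist \<sigma> (c s)) has_vector_derivative w) (at t)"
      by (rule has_vector_derivative_cong_nhds[OF w(1)])
    moreover have "contact_form (twist \<sigma> (c t)) w = twist_factor \<sigma> (c t) * contact_form (c t) v"
      using w(2) True by (simp add: twist_def twist_factor_def W'(2))
    ultimately show ?thesis by blast
  next
    case False
    \<comment> \<open>A curve starting on the equator may enter z < 0, but for a short time it stays
      where the twist is the identity.\<close>
    have "\<forall>\<^sub>F s in nhds t. height (c s) > - 1 / 10"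
      using cont False by (simp add: order_tendstoD(1) isCont_def eventually_nhds_conv_at)
    then have "\<forall>\<^sub>F s in nhds t. c s = twist \<sigma> (c s)"
      by eventually_elim (use c twist_trivial in auto)
    then have "((\<lambda>s. twist \<sigma> (c s)) has_vector_derivative v) (at t)"
      by (rule has_vector_derivative_cong_nhds[OF conjunct2[OF c]])
    moreover have "contact_form (twist \<sigma> (c t)) v = twist_factor \<sigma> (c t) * contact_form (c t) v"
      using False by (simp add: twist_def twist_factor_def)
    ultimately show ?thesis by blast
  qed
qed

lemma contact_symmetry_twist: "contact_symmetry (extend (twist \<sigma>))"
proof -
  have "twist \<sigma> (twist (- \<sigma>) m) = m" if "m \<in> S1xS2" for m
    using twist_twist[OF that, of "- \<sigma>"] by simp
  then show ?thesis
    using extend_diffeomorphism(1)[of "twist \<sigma>" "twist (- \<sigma>)"] conformal_extend[OF conformal_twist]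
    by (auto simp: twist_in_S1xS2 twist_twist smooth_map_on_twist contact_symmetry_def)
qed

text \<open>W = 0 is the south circle. The sum vanishes only if W and its image are both 0, so it
  has a positive minimum on the closed unit disc, while outside |W|^2 alone is at least 1. A uniform
  bound is needed because \<open>k\<close> must not depend on the point.\<close>

lemma twist_displaces_origin:
  obtains \<delta> where "\<delta> > 0" "\<And>W. (cmod W)\<^sup>2 + (cmod (twist_disc 1 W))\<^sup>2 \<ge> \<delta>"
proof -
  define f where "f W = (cmod W)\<^sup>2 + (cmod (twist_disc 1 W))\<^sup>2" for W
  have "smooth_on_open UNIV (\<lambda>W::complex. W)"
    by (intro smooth_on_open_bounded_linear open_UNIV bounded_linear_ident)
  then have "smooth_on_open UNIV f"
    unfolding f_def
    by (intro smooth_on_open_add smooth_on_open_norm_square smooth_on_open_twist_disc)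
  then have "continuous_on (cball 0 1) f"
    using smooth_on_open_continuous_on continuous_on_subset by blast
  then obtain W0 where W0: "W0 \<in> cball 0 1" "\<And>W. W \<in> cball 0 1 \<Longrightarrow> f W0 \<le> f W"
    using continuous_attains_inf[of "cball (0::complex) 1" f] by auto
  have "f W0 > 0"
  proof (cases "W0 = 0")
    case True
    have "twist_disc 1 0 \<noteq> 0"
    proof
      assume "twist_disc 1 0 = 0"
      \<comment> \<open>At W = 0 the angle is \<open>flat 2 1\<close>, that is exp (-1), which lies
        strictly between 0 and pi.\<close>
      then have "sin (exp (- 1)) = (0::real)"
        by (simp add: twist_disc_def twist_angle_def flat_def complex_eq_iff)
      moreover have "exp (- 1) < (1::real)" by simp
      then have "exp (- 1) < pi" using pi_gt3 by linarith
      ultimately show False using sin_gt_zero[of "exp (- 1)"] by simp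
    qed
    then show ?thesis by (simp add: f_def True)
  qed (simp add: f_def add_pos_nonneg)
  moreover have "f W \<ge> min 1 (f W0)" for W
  proof (cases "W \<in> cball 0 1")
    case False
    then have "1 \<le> (cmod W)\<^sup>2" by simp
    then show ?thesis by (simp add: f_def min_def add_increasing2)
  qed (use W0(2) in \<open>auto simp: min_le_iff_disj\<close>)
  ultimately show ?thesis using that[of "min 1 (f W0)"] by (simp add: f_def)
qed

subsection \<open>The positive loop\<close>

definition twisted_loop :: "nat \<Rightarrow> real \<Rightarrow> ambient \<Rightarrow> ambient" where
  "twisted_loop k t = extend (rotation (2 * pi * t) (2 * pi * k * t)) \<circ> extend (twist 1) \<circ>
     extend (rotation 0 (2 * pi * k * t)) \<circ> extend (twist (-1))"

lemma twisted_loop_eq: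
  "m \<in> S1xS2 \<Longrightarrow> twisted_loop k t m = rotation (2 * pi * t) (2 * pi * k * t)
     (twist 1 (rotation 0 (2 * pi * k * t) (twist (-1) m)))"
  by (simp add: twisted_loop_def extend_def twist_in_S1xS2)

lemma twisted_loop_outside: "m \<notin> S1xS2 \<Longrightarrow> twisted_loop k t m = m"
  by (simp add: twisted_loop_def extend_def)

lemma contact_symmetry_twisted_loop: "contact_symmetry (twisted_loop k t)"
  unfolding twisted_loop_def
  by (intro contact_symmetry_comp contact_symmetry_rotation contact_symmetry_twist)

lemma twisted_loop_0: "twisted_loop k 0 = id"
proof
  fix m
  show "twisted_loop k 0 m = id m"
    using twist_twist[of m "-1"]
    by (cases "m \<in> S1xS2") (simp_all add: twisted_loop_eq twisted_loop_outside)
qed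

lemma twisted_loop_periodic: "twisted_loop k (t + 1) = twisted_loop k t"
proof -
  have "cis (2 * pi * k * (t + 1)) = cis (2 * pi * k * t)" for k :: nat
    using cis_multiple_2pi[of "real k"]
    by (simp add: distrib_left flip: cis_mult)
  \<comment> \<open>Instance \<open>k\<close> closes the rotation of the plane, instance 1 that of
    the circle.\<close>
  from this[of k] this[of 1] show ?thesis
    by (simp add: twisted_loop_def rotation_def[abs_def])
qed

lemma smooth_map_on_rotation_compose:
  fixes f :: "real \<times> ambient \<Rightarrow> ambient"
  assumes "smooth_map_on N f"
  shows "smooth_map_on N (\<lambda>x. rotation (a * fst x) (b * fst x) (f x))"
proof -
  have "smooth_on_open UNIV (\<lambda>x::real \<times> ambient. rotation (a * fst x) (b * fst x) (snd x))"
    by (intro smooth_on_open_rotation smooth_on_open_mult smooth_on_open_const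
        smooth_on_open_bounded_linear open_UNIV bounded_linear_fst bounded_linear_snd)
  then have "smooth_map_on UNIV (\<lambda>x::real \<times> ambient. rotation (a * fst x) (b * fst x) (snd x))"
    by (simp add: smooth_on_open_iff_smooth_map_on)
  from smooth_map_on_compose[OF smooth_map_on_Pair[OF smooth_map_on_linear[OF bounded_linear_fst] assms] this]
  show ?thesis by simp
qed

lemma smooth_contact_loop_twisted_loop: "smooth_contact_loop (twisted_loop k)"
proof -
  let ?N = "UNIV \<times> S1xS2 :: (real \<times> ambient) set"
  have "smooth_map_on ?N (\<lambda>x. twist (-1) (snd x))"
    by (rule smooth_map_on_compose[OF smooth_map_on_linear[OF bounded_linear_snd] smooth_map_on_twist]) auto
  then have "smooth_map_on ?N (\<lambda>x. rotation (0 * fst x) (2 * pi * k * fst x) (twist (-1) (snd x)))"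
    by (rule smooth_map_on_rotation_compose)
  then have "smooth_map_on ?N (\<lambda>x. twist 1 (rotation (0 * fst x) (2 * pi * k * fst x) (twist (-1) (snd x))))"
    by (rule smooth_map_on_compose[OF _ smooth_map_on_twist]) (auto simp: twist_in_S1xS2)
  from smooth_map_on_rotation_compose[OF this, of "2 * pi" "2 * pi * k"]
  have "smooth_map_on ?N (\<lambda>(t, m). twisted_loop k t m)"
    by (rule smooth_map_on_cong) (auto simp: twisted_loop_eq)
  then show ?thesis
    by (simp add: smooth_contact_loop_def twisted_loop_0 twisted_loop_periodic
        contact_symmetry_imp_contactomorphism[OF contact_symmetry_twisted_loop])
qed

text \<open>This is the Hamiltonian of the loop divided by 2 pi, with \<open>n\<close> the point to
  which the inner \<open>twist 1\<close> is applied. For z < 0 the conformal factor converts every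
  term to a multiple of the new depth, and what remains is k (|W1|^2 + |W|^2) - 1. For z >= 0 the
  twist is trivial, and height and planar part are not both zero.\<close>

lemma twisted_hamiltonian_positive:
  assumes "\<delta> > 0" "\<And>W. (cmod W)\<^sup>2 + (cmod (twist_disc 1 W))\<^sup>2 \<ge> \<delta>" "k * \<delta> > 1" "n \<in> S1xS2"
  shows "height (twist 1 n) + k * (cmod (planar (twist 1 n)))\<^sup>2
     + twist_factor 1 n * (k * (cmod (planar n))\<^sup>2) > 0"
proof (cases "height n < 0")
  case True
  define W W1 where "W = plane n" and "W1 = twist_disc 1 W"
  have "depth W1 > 0" by (rule depth_pos)
  have "k > 0" using assms(1,3) by (metis less_trans zero_less_mult_pos2 zero_less_one)
  have "1 < k * ((cmod W1)\<^sup>2 + (cmod W)\<^sup>2)"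
    using assms(3) mult_left_mono[OF assms(2)[of W], of k] \<open>k > 0\<close>
    unfolding W1_def add.commute[of "(cmod W)\<^sup>2"] by linarith
  then have "0 < depth W1 * (k * ((cmod W1)\<^sup>2 + (cmod W)\<^sup>2) - 1)"
    using \<open>depth W1 > 0\<close> by simp
  also have "\<dots> = height (twist 1 n) + k * (cmod (planar (twist 1 n)))\<^sup>2
     + twist_factor 1 n * (k * (cmod (planar n))\<^sup>2)"
    using True \<open>depth W1 > 0\<close> unfolding planar_norm[OF assms(4) True]
    by (simp add: twist_factor_def twist_def power_mult_distrib W_def[symmetric] W1_def[symmetric] algebra_simps)
  finally show ?thesis .
next
  case False
  have "k > 0" using assms(1,3) by (metis less_trans zero_less_mult_pos2 zero_less_one)
  have "(cmod (planar n))\<^sup>2 + (height n)\<^sup>2 = 1" using assms(4) by (simp add: S1xS2_iff)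
  then have "height n > 0 \<or> (cmod (planar n))\<^sup>2 > 0" using False by (cases "planar n = 0"; cases "height n = 0") auto
  then have "height n + 2 * k * (cmod (planar n))\<^sup>2 > 0"
    using False \<open>k > 0\<close> by (auto intro: add_pos_nonneg add_nonneg_pos simp: not_less)
  then show ?thesis using False by (simp add: twist_def twist_factor_def)
qed

text \<open>The generating field at \<open>m\<close> is the velocity of the trajectory of its
  preimage \<open>n\<close>. Starting from the fixed point \<open>twist (-1) n\<close>, the inner
  rotation creates the first term, \<open>twist 1\<close> multiplies it by the conformal factor, and
  the outer rotation adds its own Hamiltonian.\<close>

lemma positive_twisted_loop:
  assumes "\<delta> > 0" "\<And>W. (cmod W)\<^sup>2 + (cmod (twist_disc 1 W))\<^sup>2 \<ge> \<delta>" "real k * \<delta> > 1"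
  shows "positive_loop (twisted_loop k)"
  unfolding positive_loop_def
proof (intro conjI allI ballI smooth_contact_loop_twisted_loop)
  fix t m assume m: "m \<in> S1xS2"
  have f: "diffeomorphism (twisted_loop k t)"
    using contact_symmetry_twisted_loop by (simp add: contact_symmetry_def)
  define n where "n = inv (twisted_loop k t) m"
  have n: "n \<in> S1xS2" "twisted_loop k t n = m"
    using m diffeomorphism_mem[OF diffeomorphism_inv[OF f]] diffeomorphism_inverses[OF f]
    by (simp_all add: n_def)
  define c where "c s = rotation 0 (2 * pi * k * s) (twist (-1) n)" for s
  have c: "c s \<in> S1xS2" for s using n by (simp add: c_def twist_in_S1xS2)
  have lin: "((\<lambda>s. a * s) has_real_derivative a) (at t)" for a
    by (auto intro!: derivative_eq_intros)
  obtain v where "((\<lambda>s. rotation 0 (2 * pi * k * s) (twist (-1) n)) has_vector_derivative v) (at t)"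
    "contact_form (rotation 0 (2 * pi * k * t) (twist (-1) n)) v = contact_form (twist (-1) n) 0 +
       0 * height (twist (-1) n) + 2 * pi * k * (cmod (planar (twist (-1) n)))\<^sup>2"
    using rotation_derivative[OF twist_in_S1xS2[OF n(1)] has_vector_derivative_const DERIV_const lin] by blast
  then have v: "(c has_vector_derivative v) (at t)"
    "contact_form (c t) v = 2 * pi * k * (cmod (planar (c t)))\<^sup>2"
    by (simp_all add: c_def[abs_def] norm_mult contact_form_def[of _ 0])
  obtain w where w: "((\<lambda>s. twist 1 (c s)) has_vector_derivative w) (at t)"
    "contact_form (twist 1 (c t)) w = twist_factor 1 (c t) * contact_form (c t) v"
    using conformalD[OF conformal_twist c v(1)] by blast
  obtain x where x: "((\<lambda>s. rotation (2 * pi * s) (2 * pi * k * s) (twist 1 (c s))) has_vector_derivative x) (at t)"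
    "contact_form (rotation (2 * pi * t) (2 * pi * k * t) (twist 1 (c t))) x =
       contact_form (twist 1 (c t)) w + 2 * pi * height (twist 1 (c t))
         + 2 * pi * k * (cmod (planar (twist 1 (c t))))\<^sup>2"
    using rotation_derivative[OF twist_in_S1xS2[OF c] w(1) lin lin] by blast
  have eq: "twisted_loop k s n = rotation (2 * pi * s) (2 * pi * k * s) (twist 1 (c s))" for s
    using n by (simp add: twisted_loop_eq c_def)
  have "generating_field (twisted_loop k) t m = x"
    using x(1) by (simp add: generating_field_def n_def[symmetric] eq vector_derivative_at)
  moreover have "contact_form m x = 2 * pi * (height (twist 1 (c t)) + k * (cmod (planar (twist 1 (c t))))\<^sup>2
     + twist_factor 1 (c t) * (k * (cmod (planar (c t)))\<^sup>2))"
    using x(2) w(2) v(2) n(2) eq[of t] by (simp add: algebra_simps)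
  ultimately show "contact_form m (generating_field (twisted_loop k) t m) > 0"
    using twisted_hamiltonian_positive[OF assms c[of t]] by simp
qed

subsection \<open>Smooth loops are continuous in the \<open>C\<^sup>\<infinity>\<close> topology\<close>

text \<open>Spatial derivatives at time \<open>t\<close> become derivatives of the joint map in
  directions (0, v), so joint smoothness makes them continuous in (t, x) together.\<close>

lemma iterated_derivative_slice:
  fixes F :: "'a::euclidean_space \<times> 'b::euclidean_space \<Rightarrow> 'c::real_normed_vector"
  assumes F: "smooth_on_open (UNIV \<times> U) F" and "open U" "x \<in> U"
  shows "iterated_derivative vs (\<lambda>x. F (t, x)) x = iterated_derivative (map (Pair 0) vs) F (t, x)"
  using assms(3)
proof (induction vs arbitrary: x)
  case (Cons v vs)
  let ?G = "iterated_derivative (map (Pair 0) vs) F"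
  obtain D where D: "(?G has_derivative D) (at (t, x))"
  proof -
    have "?G differentiable (at (t, x))"
      using F Cons.prems unfolding smooth_on_open_def by blast
    then show ?thesis using that unfolding differentiable_def by blast
  qed
  have "((\<lambda>x. (t, x)) has_derivative Pair 0) (at x)"
    by (intro has_derivative_Pair has_derivative_const has_derivative_ident)
  then have "((\<lambda>x. ?G (t, x)) has_derivative (\<lambda>v. D (0, v))) (at x)"
    using D has_derivative_compose by blast
  then have "frechet_derivative (\<lambda>x. ?G (t, x)) (at x) = (\<lambda>v. D (0, v))"
    using frechet_derivative_at by metis
  moreover have "frechet_derivative ?G (at (t, x)) = D"
    using D frechet_derivative_at by metis
  moreover have "frechet_derivative (iterated_derivative vs (\<lambda>x. F (t, x))) (at x) =
      frechet_derivative (\<lambda>x. ?G (t, x)) (at x)"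
    by (rule frechet_derivative_cong_open[OF assms(2) Cons.prems]) (rule Cons.IH)
  ultimately show ?case by simp
qed simp

text \<open>A form of the tube lemma: the complement is the projection of the compact set where h >=
  \<epsilon>, hence closed.\<close>

lemma openin_compact_parameter:
  fixes h :: "'a::metric_space \<times> 'b::metric_space \<Rightarrow> real"
  assumes "compact T" "compact K" "continuous_on (T \<times> K) h"
  shows "openin (top_of_set T) {t \<in> T. \<forall>x\<in>K. h (t, x) < \<epsilon>}"
proof -
  define B where "B = T \<times> K \<inter> h -` {\<epsilon>..}"
  have "closedin (top_of_set (T \<times> K)) B"
    unfolding B_def by (rule continuous_closedin_preimage[OF assms(3)]) simp
  then have "compact B"
    using assms closedin_compact compact_Times by blast
  then have "compact (fst ` B)"
    by (intro compact_continuous_image continuous_intros)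
  then have "closedin (top_of_set T) (fst ` B)"
    by (intro closed_subset compact_imp_closed) (auto simp: B_def)
  then have "openin (top_of_set T) (T - fst ` B)" by (simp add: openin_diff)
  moreover have "T - fst ` B = {t \<in> T. \<forall>x\<in>K. h (t, x) < \<epsilon>}"
    unfolding B_def by (force simp: not_le)
  ultimately show ?thesis by simp
qed

lemma local_parametrization_mem:
  "local_parametrization U \<psi> \<Longrightarrow> x \<in> U \<Longrightarrow> \<psi> x \<in> S1xS2"
  unfolding local_parametrization_def by (auto dest!: openin_imp_subset)

lemma smooth_loop_preimage_open:
  assumes \<phi>: "smooth_map_on (UNIV \<times> S1xS2) (\<lambda>(t, m). \<phi> t m)" and \<psi>: "local_parametrization U \<psi>"
    and K: "compact K" "K \<subseteq> U" and f: "smooth_map_on S1xS2 f" and "compact T"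
  shows "openin (top_of_set T) {t \<in> T. \<forall>x\<in>K.
     dist (iterated_derivative vs (\<phi> t \<circ> \<psi>) x) (iterated_derivative vs (f \<circ> \<psi>) x) < \<epsilon>}"
proof -
  have U: "smooth_on_open U \<psi>" "open U"
    using \<psi> by (auto simp: local_parametrization_def smooth_on_open_def)
  note \<psi>U = local_parametrization_mem[OF \<psi>]
  have \<psi>': "smooth_map_on U \<psi>" using U by (simp add: smooth_on_open_iff_smooth_map_on)
  have "smooth_map_on U (\<lambda>x. f (\<psi> x))"
    by (rule smooth_map_on_compose[OF \<psi>' f]) (use \<psi>U in auto)
  then have 1: "smooth_on_open U (f \<circ> \<psi>)"
    using U by (simp add: smooth_on_open_iff_smooth_map_on comp_def)
  define \<Psi> where "\<Psi> p = \<phi> (fst p) (\<psi> (snd p))" for p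
  have "smooth_map_on (UNIV \<times> U) (\<lambda>p. \<psi> (snd p))"
    by (rule smooth_map_on_compose[OF smooth_map_on_linear[OF bounded_linear_snd] \<psi>']) auto
  moreover have "(\<lambda>p. (fst p, \<psi> (snd p))) ` (UNIV \<times> U) \<subseteq> UNIV \<times> S1xS2" using \<psi>U by auto
  ultimately have "smooth_map_on (UNIV \<times> U) \<Psi>"
    using smooth_map_on_compose[OF smooth_map_on_Pair[OF smooth_map_on_linear[OF bounded_linear_fst]] \<phi>]
    by (fastforce simp: \<Psi>_def[abs_def])
  then have 2: "smooth_on_open (UNIV \<times> U) \<Psi>"
    using U by (simp add: smooth_on_open_iff_smooth_map_on open_Times)
  have "iterated_derivative vs (\<phi> t \<circ> \<psi>) x = iterated_derivative (map (Pair 0) vs) \<Psi> (t, x)"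
    if "x \<in> K" for t x
    using iterated_derivative_slice[OF 2 U(2), of x vs t] that K by (auto simp: \<Psi>_def comp_def)
  moreover have "continuous_on (T \<times> K) (\<lambda>p. dist (iterated_derivative (map (Pair 0) vs) \<Psi> p)
      (iterated_derivative vs (f \<circ> \<psi>) (snd p)))"
    using K(2) by (intro continuous_intros
        continuous_on_subset[OF smooth_on_open_iterated_derivative_continuous[OF 2]]
        continuous_on_compose2[OF smooth_on_open_iterated_derivative_continuous[OF 1]]) auto
  note openin_compact_parameter[OF \<open>compact T\<close> K(1) this, of \<epsilon>]
  ultimately show ?thesis by simp
qed

subsection \<open>Evaluation at the north pole\<close>

definition chart :: "real ^ 3 \<Rightarrow> ambient" where
  "chart x = point (Complex (sqrt (1 - (x $ 1)\<^sup>2)) (x $ 1)) (Complex (x $ 2) (x $ 3))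
     (sqrt (1 - (x $ 2)\<^sup>2 - (x $ 3)\<^sup>2))"

definition chart_inverse :: "ambient \<Rightarrow> real ^ 3" where
  "chart_inverse m = vector [Im (fst m), Re (planar m), Im (planar m)]"

definition chart_domain :: "(real ^ 3) set" where
  "chart_domain = {x. 0 < 1 - (x $ 1)\<^sup>2 \<and> 0 < 1 - (x $ 2)\<^sup>2 - (x $ 3)\<^sup>2}"

lemma chart_inverse_chart: "chart_inverse (chart x) = x"
  by (simp add: chart_inverse_def chart_def vec_eq_iff forall_3)

lemma bounded_linear_chart_inverse: "bounded_linear chart_inverse"
  unfolding linear_conv_bounded_linear [symmetric]
  by (rule linearI) (auto simp: chart_inverse_def planar_def vec_eq_iff forall_3)

lemma open_chart_domain: "open chart_domain"
  unfolding chart_domain_def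
  by (intro open_Collect_conj open_Collect_less continuous_intros)

lemma smooth_on_open_chart: "smooth_on_open chart_domain chart"
proof -
  have c: "smooth_on_open chart_domain (\<lambda>x. x $ i)" for i
    by (rule smooth_on_open_bounded_linear[OF open_chart_domain bounded_linear_vec_nth])
  have *: "Complex a b = a *\<^sub>R 1 + b *\<^sub>R \<i>" for a b
    by (simp add: complex_eq_iff)
  show ?thesis
    unfolding chart_def *
    by (intro smooth_on_open_point smooth_on_open_add smooth_on_open_scaleR smooth_on_open_sqrt
        smooth_on_open_diff smooth_on_open_power2 smooth_on_open_const c open_chart_domain)
      (auto simp: chart_domain_def)
qed

lemma chart_image: "chart ` chart_domain = {m \<in> S1xS2. Re (fst m) > 0 \<and> height m > 0}"
proof (intro equalityI subsetI)
  fix m assume m: "m \<in> {m \<in> S1xS2. Re (fst m) > 0 \<and> height m > 0}"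
  then have 1: "1 - (Im (fst m))\<^sup>2 = (Re (fst m))\<^sup>2"
    by (auto simp: S1xS2_iff cmod_def)
  have 2: "1 - (Re (planar m))\<^sup>2 - (Im (planar m))\<^sup>2 = (height m)\<^sup>2"
    using m by (auto simp: S1xS2_iff cmod_power2)
  have "chart (chart_inverse m) = m"
    using m by (intro ambient_eqI) (simp_all add: chart_def chart_inverse_def 1 2)
  moreover have "0 < 1 - (Im (fst m))\<^sup>2" "0 < 1 - (Re (planar m))\<^sup>2 - (Im (planar m))\<^sup>2"
    unfolding 1 2 using m by auto
  then have "chart_inverse m \<in> chart_domain"
    by (simp add: chart_domain_def chart_inverse_def)
  ultimately show "m \<in> chart ` chart_domain" by (metis imageI)
qed (auto simp: chart_def chart_domain_def S1xS2_iff cmod_def)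

text \<open>The left inverse \<open>chart_inverse\<close> is linear on the ambient space. It is
  therefore continuous, and differentiating \<open>chart_inverse (chart x) = x\<close> gives the
  differential of the chart a left inverse.\<close>

lemma local_parametrization_chart: "local_parametrization chart_domain chart"
  unfolding local_parametrization_def
proof (intro conjI ballI)
  have "open {m. 0 < Re (fst m) \<and> 0 < height m}"
    by (intro open_Collect_conj open_Collect_less continuous_intros
      bounded_linear.continuous_on[OF bounded_linear_height])
  moreover have "chart ` chart_domain = S1xS2 \<inter> {m. 0 < Re (fst m) \<and> 0 < height m}"
    by (auto simp: chart_image)
  ultimately show "openin (top_of_set S1xS2) (chart ` chart_domain)"
    by (simp add: openin_open_Int)
  have "homeomorphism chart_domain (chart ` chart_domain) chart chart_inverse"
    by (intro homeomorphismI smooth_on_open_continuous_on smooth_on_open_chart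
        linear_continuous_on bounded_linear_chart_inverse) (auto simp: chart_inverse_chart)
  then show "\<exists>\<zeta>. homeomorphism chart_domain (chart ` chart_domain) chart \<zeta>"
    by (rule exI[of _ chart_inverse])
  fix x assume "x \<in> chart_domain"
  then have "(chart has_derivative frechet_derivative chart (at x)) (at x)"
    using smooth_on_open_chart Ck_SucD(1)[of 0 chart_domain chart x]
    unfolding smooth_on_open_iff_Ck by blast
  then have "((\<lambda>x. chart_inverse (chart x)) has_derivative
      (\<lambda>v. chart_inverse (frechet_derivative chart (at x) v))) (at x)"
    by (rule bounded_linear.has_derivative[OF bounded_linear_chart_inverse])
  then have "((\<lambda>x. x) has_derivative (\<lambda>v. chart_inverse (frechet_derivative chart (at x) v))) (at x)"
    by (simp add: chart_inverse_chart)
  then have "(\<lambda>v. chart_inverse (frechet_derivative chart (at x) v)) = (\<lambda>v. v)"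
    using has_derivative_unique has_derivative_ident by blast
  then show "inj (frechet_derivative chart (at x))"
    by (metis injI)
qed (rule smooth_on_open_chart)

lemma smooth_nbhd_chart_open:
  assumes "smooth_map_on S1xS2 f" "x \<in> chart_domain" "\<epsilon> > 0"
  shows "openin smooth_topology (smooth_nbhd chart {x} [] \<epsilon> f)"
  unfolding smooth_topology_def
  by (rule topology_generated_by_Basis)
    (use assms local_parametrization_chart in \<open>intro CollectI exI[of _ chart] exI[of _ chart_domain]
       exI[of _ "{x}"] exI[of _ "[]"] exI[of _ \<epsilon>] exI[of _ f]; auto\<close>)

text \<open>A topology generated by a family lives on the union of that family; one actual chart is
  needed to place each smooth map in a neighbourhood of itself.\<close>

lemma smooth_map_on_mem_smooth_topology:
  "f \<in> topspace smooth_topology \<longleftrightarrow> smooth_map_on S1xS2 f"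
proof
  assume "f \<in> topspace smooth_topology"
  then show "smooth_map_on S1xS2 f"
    unfolding smooth_topology_def topology_generated_by_topspace by (auto simp: smooth_nbhd_def)
next
  assume f: "smooth_map_on S1xS2 f"
  have "0 \<in> chart_domain" by (simp add: chart_domain_def)
  from openin_subset[OF smooth_nbhd_chart_open[OF f this zero_less_one]]
  have "smooth_nbhd chart {0} [] 1 f \<subseteq> topspace smooth_topology" .
  then show "f \<in> topspace smooth_topology" using f by (auto simp: smooth_nbhd_def)
qed

lemma smooth_contact_loop_pathin:
  assumes "smooth_contact_loop \<phi>"
  shows "pathin Cont_topology \<phi>"
proof -
  have \<phi>: "smooth_map_on (UNIV \<times> S1xS2) (\<lambda>(t, m). \<phi> t m)" "\<And>t. \<phi> t \<in> contactomorphisms"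
    using assms by (auto simp: smooth_contact_loop_def)
  have s: "smooth_map_on S1xS2 (\<phi> t)" for t
    using \<phi>(2)[of t] by (simp add: contactomorphisms_def diffeomorphism_def)
  have "continuous_map (top_of_set {0..1}) smooth_topology \<phi>"
    unfolding smooth_topology_def
  proof (rule continuous_on_generated_topo)
    fix N assume "N \<in> {smooth_nbhd \<psi> K vs \<epsilon> f | \<psi> U K vs \<epsilon> f.
        local_parametrization U \<psi> \<and> compact K \<and> K \<subseteq> U \<and> set vs \<subseteq> Basis \<and> 0 < \<epsilon> \<and>
        smooth_map_on S1xS2 f}"
    then obtain \<psi> U K vs \<epsilon> f where N: "N = smooth_nbhd \<psi> K vs \<epsilon> f" "local_parametrization U \<psi>"
      "compact K" "K \<subseteq> U" "smooth_map_on S1xS2 f" by blast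
    have "\<phi> -` N \<inter> topspace (top_of_set {0..1}) = {t \<in> {0..1}. \<forall>x\<in>K.
       dist (iterated_derivative vs (\<phi> t \<circ> \<psi>) x) (iterated_derivative vs (f \<circ> \<psi>) x) < \<epsilon>}"
      using s by (auto simp: N(1) smooth_nbhd_def)
    then show "openin (top_of_set {0..1}) (\<phi> -` N \<inter> topspace (top_of_set {0..1}))"
      using smooth_loop_preimage_open[OF \<phi>(1) N(2-5) compact_Icc] by simp
  next
    show "\<phi> ` topspace (top_of_set {0..1}) \<subseteq> \<Union> {smooth_nbhd \<psi> K vs \<epsilon> f | \<psi> U K vs \<epsilon> f.
        local_parametrization U \<psi> \<and> compact K \<and> K \<subseteq> U \<and> set vs \<subseteq> Basis \<and> 0 < \<epsilon> \<and>
        smooth_map_on S1xS2 f}"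
      using s smooth_map_on_mem_smooth_topology
      unfolding smooth_topology_def topology_generated_by_topspace by blast
  qed
  then show ?thesis
    using \<phi>(2) by (simp add: pathin_def Cont_topology_def continuous_map_in_subtopology)
qed

definition north :: ambient where "north = point 1 0 1"

lemma north_in_S1xS2: "north \<in> S1xS2"
  by (simp add: north_def S1xS2_iff)

text \<open>A subbasic neighbourhood with compact set {0} in the chart and no derivatives bounds
  exactly the displacement of the value at \<open>north\<close>.\<close>

lemma continuous_map_evaluation:
  "continuous_map Cont_topology (top_of_set (sphere 0 1)) (\<lambda>f. fst (f north))"
proof -
  have north: "chart 0 = north" "0 \<in> chart_domain"
    by (auto simp: chart_def north_def chart_domain_def complex_eq_iff intro!: ambient_eqI)
  have "continuous_map smooth_topology euclidean (\<lambda>f. fst (f north))"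
    unfolding continuous_map_def
  proof (intro conjI allI impI)
    fix V :: "complex set" assume V: "openin euclidean V"
    let ?P = "{f \<in> topspace smooth_topology. fst (f north) \<in> V}"
    have "\<exists>N. openin smooth_topology N \<and> f \<in> N \<and> N \<subseteq> ?P" if f: "f \<in> ?P" for f
    proof -
      obtain \<epsilon> where \<epsilon>: "\<epsilon> > 0" "ball (fst (f north)) \<epsilon> \<subseteq> V"
        using f V by (auto simp: open_contains_ball)
      have sm: "smooth_map_on S1xS2 f" using f smooth_map_on_mem_smooth_topology by blast
      have "dist (fst (g north)) (fst (f north)) < \<epsilon>" if "g \<in> smooth_nbhd chart {0} [] \<epsilon> f" for g
        using that dist_fst_le[of "g north" "f north"] by (auto simp: smooth_nbhd_def north)
      then have "smooth_nbhd chart {0} [] \<epsilon> f \<subseteq> ?P"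
        using \<epsilon>(2) by (auto simp: smooth_map_on_mem_smooth_topology smooth_nbhd_def dist_commute)
      moreover have "f \<in> smooth_nbhd chart {0} [] \<epsilon> f"
        using sm \<epsilon>(1) by (simp add: smooth_nbhd_def)
      ultimately show ?thesis using smooth_nbhd_chart_open[OF sm north(2) \<epsilon>(1)] by blast
    qed
    then show "openin smooth_topology ?P" by (subst openin_subopen) blast
  qed simp
  moreover have "f north \<in> S1xS2" if "f \<in> contactomorphisms" for f
    using that north_in_S1xS2 diffeomorphism_mem by (auto simp: contactomorphisms_def)
  ultimately show ?thesis
    unfolding Cont_topology_def
    by (auto simp: continuous_map_in_subtopology S1xS2_iff intro: continuous_map_from_subtopology)
qed

lemma twisted_loop_north: "fst (twisted_loop k t north) = cis (2 * pi * t)"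
  using north_in_S1xS2 by (simp add: twisted_loop_eq twist_def north_def)

text \<open>Evaluation turns a based homotopy into a homotopy of closed loops in the unit circle,
  from \<open>circlepath 0 1\<close> to a constant. Winding numbers 1 and 0 contradict this.\<close>

lemma twisted_loop_not_null_homotopic:
  "\<not> homotopic_with (\<lambda>\<rho>. \<rho> 0 = id \<and> \<rho> 1 = id) (top_of_set {0..1}) Cont_topology
     (twisted_loop k) (\<lambda>t. id)"
proof
  assume "homotopic_with (\<lambda>\<rho>. \<rho> 0 = id \<and> \<rho> 1 = id) (top_of_set {0..1}) Cont_topology
     (twisted_loop k) (\<lambda>t. id)"
  then have "homotopic_with (\<lambda>r. pathfinish r = pathstart r) (top_of_set {0..1}) (top_of_set (sphere 0 1))
     ((\<lambda>f. fst (f north)) \<circ> twisted_loop k) ((\<lambda>f. fst (f north)) \<circ> (\<lambda>t. id))"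
    by (rule homotopic_with_compose_continuous_map_left[OF _ continuous_map_evaluation])
      (simp add: pathfinish_def pathstart_def)
  moreover have "(\<lambda>f. fst (f north)) \<circ> twisted_loop k = circlepath 0 1"
    by (rule ext) (simp add: twisted_loop_north circlepath cis_conv_exp mult_ac)
  ultimately have "homotopic_loops (sphere 0 1) (circlepath 0 1) (\<lambda>t. 1)"
    by (simp add: homotopic_loops_def comp_def north_def)
  \<comment> \<open>Winding numbers about 0 are invariant under homotopies in the punctured plane,
    so the circle is included there.\<close>
  then have "homotopic_loops (- {0}) (circlepath 0 1) (\<lambda>t. 1)"
    by (rule homotopic_loops_subset) auto
  then have "winding_number (circlepath 0 1) 0 = winding_number (\<lambda>t. 1) 0"
    by (rule winding_number_homotopic_loops)
  then show False by (simp add: winding_number_circlepath winding_number_zero_const)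
qed

theorem corollary23:
  shows "\<exists>\<phi>. positive_loop \<phi> \<and> based_loop Cont_topology id \<phi> \<and>
           pi1_class Cont_topology id \<phi> \<noteq> pi1_class Cont_topology id (\<lambda>t. id)"
proof -
  obtain \<delta> where \<delta>: "\<delta> > 0" "\<And>W. (cmod W)\<^sup>2 + (cmod (twist_disc 1 W))\<^sup>2 \<ge> \<delta>"
    using twist_displaces_origin by blast
  obtain k :: nat where k: "real k * \<delta> > 1"
    using reals_Archimedean3[OF \<delta>(1)] by blast
  \<comment> \<open>The two classes are separated by the constant loop. It belongs to its own class
    only if it is continuous, which requires \<open>id\<close> to be a point of the space.\<close>
  have "twisted_loop k 0 \<in> topspace Cont_topology"
    using smooth_contact_loop_pathin[OF smooth_contact_loop_twisted_loop[of k]]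
    unfolding pathin_def continuous_map_def by auto
  then have "id \<in> topspace Cont_topology" by (simp add: twisted_loop_0)
  then have "(\<lambda>t. id) \<in> pi1_class Cont_topology id (\<lambda>t. id)"
    by (simp add: pi1_class_def)
  moreover have "(\<lambda>t. id) \<notin> pi1_class Cont_topology id (twisted_loop k)"
    using twisted_loop_not_null_homotopic by (simp add: pi1_class_def)
  moreover have "based_loop Cont_topology id (twisted_loop k)"
    using smooth_contact_loop_pathin[OF smooth_contact_loop_twisted_loop] twisted_loop_0[of k]
      twisted_loop_periodic[of k 0]
    by (simp add: based_loop_def)
  ultimately show ?thesis
    using positive_twisted_loop[OF \<delta> k] by blast
qed

end
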